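(* Let $H$ be an atomic monoid. (1) Suppose that $\mathsf{c}(H) < \infty$ and $H$ has accepted elasticity. Then the set of distances $\Delta(H)$ is finite and there is a $K \in \mathbb{N}_0$ such that $\rho_{k+1}(H) \le \rho_k(H) + K$ for all $k \in \mathbb{N}$. (2) If $H$ is cancellative and $\omega(H) < \infty$, then $\mathsf{c}(H) \le \mathsf{t}(H) \le \omega(H)^2$, $\rho(H) \le \omega(H)$, and $\rho_{k+1}(H) \le \rho_k(H) + \max\{1, \omega(H)-1\}$ for all $k \in \mathbb{N}$. In both cases, $\mathcal{L}(H)$ satisfies the Structure Theorem for Unions.
   Context: $\mathbb{N}$ is the set of positive integers, $\mathbb{N}_0 = \mathbb{N}\cup\{0\}$; $[\![a,b]\!] = \{x \in \mathbb{Z} : a \le x \le b\}$ for $a,b\in\mathbb{R}\cup\{\pm\infty\}$; $\inf\emptyset = \infty$, $\sup\emptyset = 0$. A monoid $H$ is a commutative semigroup with identity that is unit-cancellative: if $a,u \in H$ and $a = au$, then $u \in H^\times$, where $H^\times$ is the group of invertible elements. Write $a \simeq b$ if $aH^\times = bH^\times$; $H_{\mathrm{red}} = H/\!\simeq$ is the associated reduced monoid. An atom is a non-unit $p$ such that $p = ab$ implies $a \in H^\times$ or $b \in H^\times$; $\mathcal{A}(H)$ is the set of atoms. $H$ is atomic if every non-unit is a finite product of atoms. For an atomic $H$ and a non-unit $a$, $\mathsf{L}(a) \subseteq \mathbb{N}$ is the set of all $k$ such that $a$ is a product of $k$ atoms; $\mathsf{L}(a) = \{0\}$ for $a \in H^\times$.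 $\mathcal{L}(H) = \{\mathsf{L}(a) : a \in H\}$. For $L \subseteq \mathbb{N}_0$ put $L^+ = L\cap\mathbb{N}$ and $\rho(L) = \sup L^+/\min L^+$ if $L^+ \ne\emptyset$, else $\rho(L)=1$; $\Delta(L)$ is the set of all $d \in \mathbb{N}$ for which there are $k,\ell\in L$ with $\ell-k=d$ and $L\cap[\![k,\ell]\!]=\{k,\ell\}$. Then $\Delta(H) = \bigcup_{L\in\mathcal{L}(H)}\Delta(L)$, $\rho(H) = \sup\{\rho(L): L\in\mathcal{L}(H)\}$, and for $k\in\mathbb{N}$, $\mathcal{U}_k(H) = \bigcup\{L\in\mathcal{L}(H): k\in L\}$ and $\rho_k(H) = \sup\mathcal{U}_k(H)$. If $H = H^\times$, one sets $\Delta(H)=\emptyset$, $\rho(H)=1$, $\mathcal{U}_k(H)=\{k\}$, $\rho_k(H)=k$. $H$ has accepted elasticity if $\rho(H)=\rho(L)<\infty$ for some $L\in\mathcal{L}(H)$. $L \subseteq\mathbb{N}_0$ is an AP with difference $d\in\mathbb{N}$ if $L\ne\emptyset$ and $\Delta(L)\subseteq\{d\}$; it is an AAP with difference $d$ and bound $M\in\mathbb{N}_0$ if $L\subseteq y+d\mathbb{Z}$ for some $y\in\mathbb{Z}$ and $L\cap[\![\inf L+M,\sup L-M]\!]$ is an AP with difference $d$. $\mathcal{L}(H)$ satisfies the Structure Theorem for Unions if there are $d\in\mathbb{N}$, $M\in\mathbb{N}_0$ such that $\mathcal{U}_k(H)$ is an AAP with difference $d$ and bound $M$ for all sufficiently large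 $k$. $\mathsf{Z}(H)$ is the free abelian monoid with basis $\mathcal{A}(H_{\mathrm{red}})$, $\pi:\mathsf{Z}(H)\to H_{\mathrm{red}}$ the canonical epimorphism, $\mathsf{Z}(a)=\pi^{-1}(aH^\times)$, and $|z|$ the length of $z\in\mathsf{Z}(H)$. For $z,z'\in\mathsf{Z}(H)$ with $x=\gcd(z,z')$, $z=xy$, $z'=xy'$, put $\mathsf{d}(z,z')=\max\{|y|,|y'|\}$. The catenary degree $\mathsf{c}(a)$ is the smallest $N\in\mathbb{N}_0\cup\{\infty\}$ such that any $z,z'\in\mathsf{Z}(a)$ can be joined by $z=z_0,z_1,\dots,z_k=z'$ in $\mathsf{Z}(a)$ with $\mathsf{d}(z_{i-1},z_i)\le N$ for all $i$; $\mathsf{c}(H)=\sup_{a\in H}\mathsf{c}(a)$. For $a\in H$, $\omega(H,a)$ is the smallest $N\in\mathbb{N}_0\cup\{\infty\}$ such that whenever $n\in\mathbb{N}$, $a_1,\dots,a_n\in H$ and $a_1\cdots a_n\in aH$, there is $\Omega\subseteq[\![1,n]\!]$ with $|\Omega|\le N$ and $\prod_{\nu\in\Omega}a_\nu\in aH$ (the empty product is $1$); $\omega(H)=\sup\{\omega(H,u):u\in\mathcal{A}(H)\}$. For $u\in\mathcal{A}(H_{\mathrm{red}})$, $\mathsf{t}(H,u)$ is the smallest $N\in\mathbb{N}_0\cup\{\infty\}$ such that for every $a\in H$ with $\mathsf{Z}(a)\cap u\mathsf{Z}(H)\neq\emptyset$ and every $z\in\mathsf{Z}(a)$ there is $z'\in\mathsf{Z}(a)\cap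 u\mathsf{Z}(H)$ with $\mathsf{d}(z,z')\le N$; $\mathsf{t}(H)=\sup\{\mathsf{t}(H,u):u\in\mathcal{A}(H_{\mathrm{red}})\}$.
   Formalization: The inequality ρ(H) ≤ ω(H) in (2) is stated only when H is not a group: if H = H^×, then there are no atoms, so ω(H) = sup ∅ = 0 while ρ(H) = 1, and the inequality fails. *)

theory Defs
  imports
    "HOL-Algebra.Divisibility"
    "HOL-Algebra.FiniteProduct"
    "HOL-Library.Multiset"
    "HOL-Library.Extended_Nonnegative_Real"
begin

section \<open>Monoids, atoms, and the associated reduced monoid\<close>

locale unit_cancellative_monoid = comm_monoid H for H (structure) +
  assumes unit_cancel: "\<lbrakk>a \<in> carrier H; u \<in> carrier H; a = a \<otimes> u\<rbrakk> \<Longrightarrow> u \<in> Units H"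

text \<open>
  The library's \<^const>\<open>irreducible\<close> is phrased through proper factors; this is the classical
  two-factor definition.
\<close>

definition atoms :: "('a, 'b) monoid_scheme \<Rightarrow> 'a set" where
  "atoms H = {p \<in> carrier H. p \<notin> Units H \<and>
     (\<forall>a\<in>carrier H. \<forall>b\<in>carrier H. p = a \<otimes>\<^bsub>H\<^esub> b \<longrightarrow> a \<in> Units H \<or> b \<in> Units H)}"

definition product_of_atoms :: "('a, 'b) monoid_scheme \<Rightarrow> nat \<Rightarrow> 'a \<Rightarrow> bool" where
  "product_of_atoms H k a \<longleftrightarrow>
     (\<exists>p. (\<forall>i\<in>{1..k}. p i \<in> atoms H) \<and> a = (\<Otimes>\<^bsub>H\<^esub>i\<in>{1..k}. p i))"

definition atomic :: "('a, 'b) monoid_scheme \<Rightarrow> bool" where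
  "atomic H \<longleftrightarrow> (\<forall>a \<in> carrier H - Units H. \<exists>k. product_of_atoms H k a)"

text \<open>The elements are the cosets $aH^\times$, multiplied as sets.\<close>

definition reduced_monoid :: "('a, 'b) monoid_scheme \<Rightarrow> 'a set monoid" where
  "reduced_monoid H =
     \<lparr>carrier = (\<lambda>a. a <#\<^bsub>H\<^esub> Units H) ` carrier H, mult = set_mult H, one = Units H\<rparr>"

section \<open>Sets of lengths\<close>

definition length_set :: "('a, 'b) monoid_scheme \<Rightarrow> 'a \<Rightarrow> nat set" where
  "length_set H a = (if a \<in> Units H then {0} else {k. product_of_atoms H k a})"

definition length_system :: "('a, 'b) monoid_scheme \<Rightarrow> nat set set" where
  "length_system H = length_set H ` carrier H"

definition delta_set :: "nat set \<Rightarrow> nat set" where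
  "delta_set L = {d. d \<ge> 1 \<and> (\<exists>k\<in>L. \<exists>l\<in>L. l = k + d \<and> L \<inter> {k..l} = {k, l})}"

definition distances :: "('a, 'b) monoid_scheme \<Rightarrow> nat set" where
  "distances H = (\<Union>L\<in>length_system H. delta_set L)"

text \<open>The infimum of a nonempty set of natural numbers is its minimum.\<close>

definition elasticity_of_set :: "nat set \<Rightarrow> ennreal" where
  "elasticity_of_set L =
     (let P = {k \<in> L. k \<ge> 1}
      in if P \<noteq> {} then ennreal_of_enat (SUP k\<in>P. enat k) / of_nat (Inf P) else 1)"

text \<open>
  If \<open>H\<close> is a group, then \<^term>\<open>length_system H\<close> is \<open>{{0}}\<close>, so that the conventions
  \<open>distances H = {}\<close> and \<open>elasticity H = 1\<close> need no separate case; for the sets \<open>unions H k\<close>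
  the convention has to be imposed.
\<close>

definition elasticity :: "('a, 'b) monoid_scheme \<Rightarrow> ennreal" where
  "elasticity H = (SUP L\<in>length_system H. elasticity_of_set L)"

definition accepted_elasticity :: "('a, 'b) monoid_scheme \<Rightarrow> bool" where
  "accepted_elasticity H \<longleftrightarrow>
     (\<exists>L\<in>length_system H. elasticity H = elasticity_of_set L \<and> elasticity_of_set L < \<infinity>)"

definition unions :: "('a, 'b) monoid_scheme \<Rightarrow> nat \<Rightarrow> nat set" where
  "unions H k =
     (if carrier H = Units H then {k} else \<Union>{L \<in> length_system H. k \<in> L})"

definition rho :: "('a, 'b) monoid_scheme \<Rightarrow> nat \<Rightarrow> enat" where
  "rho H k = (SUP l\<in>unions H k. enat l)"

section \<open>Almost arithmetical progressions\<close>

definition is_AP :: "nat \<Rightarrow> nat set \<Rightarrow> bool" where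
  "is_AP d L \<longleftrightarrow> L \<noteq> {} \<and> delta_set L \<subseteq> {d}"

text \<open>
  In \<^typ>\<open>enat\<close> the infimum of the empty set is \<open>\<infinity>\<close> and its supremum is \<open>0\<close>. The upper bound
  $x \le \sup L - M$ is written additively because subtraction on \<^typ>\<open>enat\<close> is truncated.
\<close>

definition is_AAP :: "nat \<Rightarrow> nat \<Rightarrow> nat set \<Rightarrow> bool" where
  "is_AAP d M L \<longleftrightarrow>
     (\<exists>y::int. \<forall>x\<in>L. int d dvd (int x - y)) \<and>
     is_AP d {x \<in> L. (INF l\<in>L. enat l) + enat M \<le> enat x \<and>
                     enat x + enat M \<le> (SUP l\<in>L. enat l)}"

definition structure_theorem_for_unions :: "('a, 'b) monoid_scheme \<Rightarrow> bool" where
  "structure_theorem_for_unions H \<longleftrightarrow>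
     (\<exists>d\<ge>1. \<exists>M. \<exists>k0. \<forall>k\<ge>k0. is_AAP d M (unions H k))"

section \<open>Factorizations, catenary degree, and tame degree\<close>

text \<open>
  The free abelian monoid over the atoms of the reduced monoid is realised by multisets:
  multiset sum is its multiplication, \<^const>\<open>size\<close> its length function, and multiset
  intersection its greatest common divisor.
\<close>

definition factorization_monoid :: "('a, 'b) monoid_scheme \<Rightarrow> 'a set multiset set" where
  "factorization_monoid H = {z. set_mset z \<subseteq> atoms (reduced_monoid H)}"

definition factorization_prod :: "('a, 'b) monoid_scheme \<Rightarrow> 'a set multiset \<Rightarrow> 'a set" where
  "factorization_prod H z =
     (\<Otimes>\<^bsub>reduced_monoid H\<^esub>u\<in>set_mset z. u [^]\<^bsub>reduced_monoid H\<^esub> count z u)"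

definition factorizations :: "('a, 'b) monoid_scheme \<Rightarrow> 'a \<Rightarrow> 'a set multiset set" where
  "factorizations H a =
     {z \<in> factorization_monoid H. factorization_prod H z = a <#\<^bsub>H\<^esub> Units H}"

definition fdist :: "'c multiset \<Rightarrow> 'c multiset \<Rightarrow> nat" where
  "fdist z z' = (let x = z \<inter># z' in max (size (z - x)) (size (z' - x)))"

definition catenary_degree_at :: "('a, 'b) monoid_scheme \<Rightarrow> 'a \<Rightarrow> enat" where
  "catenary_degree_at H a =
     (LEAST N. \<forall>z\<in>factorizations H a. \<forall>z'\<in>factorizations H a.
        \<exists>(k::nat) c. c 0 = z \<and> c k = z' \<and> (\<forall>i\<le>k. c i \<in> factorizations H a) \<and>
          (\<forall>i\<in>{1..k}. enat (fdist (c (i - 1)) (c i)) \<le> N))"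

definition catenary_degree :: "('a, 'b) monoid_scheme \<Rightarrow> enat" where
  "catenary_degree H = (SUP a\<in>carrier H. catenary_degree_at H a)"

definition tame_degree_at :: "('a, 'b) monoid_scheme \<Rightarrow> 'a set \<Rightarrow> enat" where
  "tame_degree_at H u =
     (LEAST N. \<forall>a\<in>carrier H.
        factorizations H a \<inter> add_mset u ` factorization_monoid H \<noteq> {} \<longrightarrow>
        (\<forall>z\<in>factorizations H a.
           \<exists>z'\<in>factorizations H a \<inter> add_mset u ` factorization_monoid H.
             enat (fdist z z') \<le> N))"

definition tame_degree :: "('a, 'b) monoid_scheme \<Rightarrow> enat" where
  "tame_degree H = (SUP u\<in>atoms (reduced_monoid H). tame_degree_at H u)"

section \<open>The invariant omega\<close>

text \<open>Membership $x \in aH$ is the library's divisibility relation.\<close>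

definition omega_at :: "('a, 'b) monoid_scheme \<Rightarrow> 'a \<Rightarrow> enat" where
  "omega_at H a =
     (LEAST N. \<forall>n\<ge>1::nat. \<forall>b. (\<forall>i\<in>{1..n}. b i \<in> carrier H) \<longrightarrow>
        a divides\<^bsub>H\<^esub> (\<Otimes>\<^bsub>H\<^esub>i\<in>{1..n}. b i) \<longrightarrow>
        (\<exists>S\<subseteq>{1..n}. enat (card S) \<le> N \<and> a divides\<^bsub>H\<^esub> (\<Otimes>\<^bsub>H\<^esub>i\<in>S. b i)))"

definition omega :: "('a, 'b) monoid_scheme \<Rightarrow> enat" where
  "omega H = (SUP u\<in>atoms H. omega_at H u)"

end

theory Submission
  imports Defs
begin

text \<open>
  Catenary degree and distances: along a chain of factorizations joining two adjacent lengths one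
  step must jump over the gap, so \<open>sup \<Delta>(H) \<le> c(H)\<close>. If the elasticity \<open>m / n\<close> is attained and
  \<open>k = q n + r\<close> with \<open>r < n\<close>, then \<open>q m + r \<in> U\<^sub>k\<close>, while every element of \<open>U\<^sub>k\<^sub>+\<^sub>1\<close> is at
  most \<open>(q + 1) m\<close>; hence \<open>K = m\<close> works.

  In the cancellative case, if \<open>u\<close> divides \<open>v\<^sub>1 \<dots> v\<^sub>n\<close>, then \<open>u b\<close> is a product of at most
  \<open>\<omega>(H)\<close> of the \<open>v\<^sub>i\<close>. Cancelling atom by atom shows that a product of \<open>k\<close> atoms has no
  factorization longer than \<open>k \<omega>(H)\<close>, which bounds both \<open>\<rho>(H)\<close> and the length of \<open>u b\<close>, hence
  \<open>t(H)\<close>; cancelling a single atom gives the bound for \<open>\<rho>\<^sub>k\<^sub>+\<^sub>1\<close>.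

  For the Structure Theorem let \<open>d = min \<Delta>(H)\<close>, which divides all distances. Powers of an element
  with lengths \<open>x, x + d\<close> have an arbitrarily long progression of lengths with difference \<open>d\<close>; added
  to \<open>U\<^sub>n\<close>, whose gaps are bounded, it fills the whole residue class modulo \<open>d\<close> between \<open>k\<close> and
  \<open>\<rho>\<^sub>k - M\<close>. The part below \<open>k\<close> follows because \<open>l \<in> U\<^sub>k\<close> is symmetric in \<open>k\<close> and \<open>l\<close>.
\<close>

section \<open>Gaps in sets of natural numbers\<close>

text \<open>The witness is the distance from \<open>x\<close> to its successor in \<open>L\<close>,
  which is adjacent to \<open>x\<close> by minimality.\<close>

lemma delta_set_next:
  assumes "x \<in> L" "y \<in> L" "x < y"
  obtains e where "e \<in> delta_set L" "x + e \<in> L" "x + e \<le> y"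
proof -
  define w where "w = (LEAST w. w \<in> L \<and> x < w)"
  have w: "w \<in> L" "x < w" using LeastI[of "\<lambda>w. w \<in> L \<and> x < w" y] assms by (auto simp: w_def)
  have least: "w \<le> v" if "v \<in> L" "x < v" for v
    using that by (auto simp: w_def intro: Least_le)
  have "v \<in> {x, w}" if "v \<in> L \<inter> {x..w}" for v
    using least[of v] that by fastforce
  then have "L \<inter> {x..w} = {x, w}" using w assms(1) by (intro antisym subsetI) auto
  moreover have "w - x \<ge> 1" "w = x + (w - x)" using w by auto
  ultimately have "w - x \<in> delta_set L"
    using w assms(1) unfolding delta_set_def by blast
  with that[of "w - x"] w least[OF assms(2,3)] show ?thesis by auto
qed

text \<open>Take \<open>p\<close> as the largest element of \<open>L\<close> up to \<open>t\<close>.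
  Unless \<open>p = t\<close>, its successor in \<open>L\<close> lies beyond \<open>t\<close> and at
  most \<open>D\<close> above \<open>p\<close>.\<close>

lemma delta_set_gap_bound:
  assumes "\<And>e. e \<in> delta_set L \<Longrightarrow> e \<le> D" "x \<in> L" "y \<in> L" "x \<le> t" "t \<le> y"
  obtains p where "p \<in> L" "p \<le> t" "t \<le> p + D"
proof -
  let ?S = "{l \<in> L. l \<le> t}"
  define p where "p = Max ?S"
  have fin: "finite ?S" by (rule finite_subset[of _ "{..t}"]) auto
  then have p: "p \<in> ?S" using assms unfolding p_def by (intro Max_in) auto
  show ?thesis
  proof (cases "p = t")
    case True
    with that[of p] p show ?thesis by auto
  next
    case False
    then have "p < y" using p assms(5) by auto
    then obtain e where e: "e \<in> delta_set L" "p + e \<in> L"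
      using delta_set_next[of p L y] p assms(3) by blast
    then have "e \<ge> 1" by (simp add: delta_set_def)
    then have "\<not> p + e \<le> t" using e Max_ge[OF fin, of "p + e"] by (auto simp: p_def)
    with that[of p] p e assms(1)[of e] show ?thesis by auto
  qed
qed

text \<open>Passing from successor to successor joins the smaller element to the larger by distances
  of \<open>L\<close>, so \<open>L\<close> lies in one residue class modulo
  \<open>d\<close>.\<close>

lemma delta_set_dvd_diff:
  assumes "\<And>e. e \<in> delta_set L \<Longrightarrow> d dvd e" "x \<in> L" "y \<in> L"
  shows "int d dvd int y - int x"
proof -
  have *: "int d dvd int v - int u" if "u \<in> L" "v \<in> L" "u \<le> v" for u v
    using that
  proof (induction "v - u" arbitrary: u rule: less_induct)
    case less
    show ?case
    proof (cases "u = v")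
      case False
      with less.prems obtain e where e: "e \<in> delta_set L" "u + e \<in> L" "u + e \<le> v"
        using delta_set_next[of u L v] by auto
      then have "e \<ge> 1" by (simp add: delta_set_def)
      then have "int d dvd int v - int (u + e)"
        using less.prems False e by (intro less.hyps) auto
      moreover have "int d dvd int e" using assms(1)[OF e(1)] by simp
      ultimately have "int d dvd (int v - int (u + e)) + int e" by (rule dvd_add)
      then show ?thesis by simp
    qed auto
  qed
  show ?thesis
    using *[of x y] *[of y x] assms(2,3) by (cases "x \<le> y") (auto simp: dvd_diff_commute)
qed

text \<open>This covers groups and the case without distances, in which every union is a
  singleton.\<close>

lemma is_AAP_singleton: "is_AAP 1 0 {k}"
proof -
  have "{x \<in> {k}. enat k + enat 0 \<le> enat x \<and> enat x + enat 0 \<le> enat k} = {k}" by auto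
  moreover have "delta_set {k} \<subseteq> {1}" by (auto simp: delta_set_def)
  ultimately show ?thesis by (simp add: is_AAP_def is_AP_def del: One_nat_def)
qed

text \<open>The reference point \<open>k\<close> fixes the residue class and keeps the middle part
  nonempty, which \<open>is_AP\<close> demands.\<close>

lemma is_AAP_finiteI:
  assumes fin: "finite U" "k \<in> U"
    and mid: "Min U + M \<le> k" "k + M \<le> Max U"
    and cls: "\<And>x. x \<in> U \<Longrightarrow> int d dvd int x - int k"
    and fill: "\<And>x. \<lbrakk>int d dvd int x - int k; Min U + M \<le> x; x + M \<le> Max U\<rbrakk> \<Longrightarrow> x \<in> U"
    and "d \<ge> 1"
  shows "is_AAP d M U"
proof -
  have ne: "U \<noteq> {}" using fin by auto
  have inf: "(INF l\<in>U. enat l) = enat (Min U)"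
    using fin ne by (intro antisym INF_lower INF_greatest) auto
  have sup: "(SUP l\<in>U. enat l) = enat (Max U)"
    using fin ne by (intro antisym SUP_upper SUP_least) auto
  define A where "A = {x \<in> U. Min U + M \<le> x \<and> x + M \<le> Max U}"
  have "delta_set A \<subseteq> {d}"
  proof
    fix e assume "e \<in> delta_set A"
    then obtain x where x: "e \<ge> 1" "x \<in> A" "x + e \<in> A" "A \<inter> {x..x + e} = {x, x + e}"
      by (auto simp: delta_set_def)
    have "int d dvd (int (x + e) - int k) - (int x - int k)"
      using x(2,3) by (intro dvd_diff cls) (simp_all add: A_def)
    then have "d dvd e" by simp
    then have le: "d \<le> e" using x(1) by (simp add: dvd_imp_le)
    have "int d dvd (int x - int k) + int d"
      using x(2) by (intro dvd_add cls) (simp_all add: A_def)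
    then have "int d dvd int (x + d) - int k" by (simp add: algebra_simps)
    \<comment> \<open>Since \<open>d \<le> e\<close>, the point \<open>x + d\<close> still lies in
      the middle part; as \<open>x\<close> and \<open>x + e\<close> are adjacent there, it must be
      \<open>x + e\<close>.\<close>
    then have "x + d \<in> A" using x le fill[of "x + d"] by (auto simp: A_def)
    then have "x + d \<in> A \<inter> {x..x + e}" using le by auto
    then show "e \<in> {d}" using x(4) \<open>d \<ge> 1\<close> by auto
  qed
  moreover have "k \<in> A" using fin mid by (simp add: A_def)
  ultimately have "is_AP d A" by (auto simp: is_AP_def)
  then show ?thesis
    unfolding is_AAP_def inf sup using cls by (auto simp: A_def)
qed

section \<open>Unions in subadditive families\<close>

text \<open>This abstracts from the sets of lengths of an atomic monoid that is not a group: lengths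
  add up in products, only units have length \<open>0\<close>, and an atom has length
  \<open>1\<close>.\<close>

locale subadditive_family =
  fixes \<L> :: "nat set set"
  assumes add_closed: "\<lbrakk>L \<in> \<L>; L' \<in> \<L>\<rbrakk> \<Longrightarrow> \<exists>L''\<in>\<L>. \<forall>x\<in>L. \<forall>y\<in>L'. x + y \<in> L''"
    and zero_mem: "{0} \<in> \<L>"
    and zero_unique: "\<lbrakk>L \<in> \<L>; 0 \<in> L\<rbrakk> \<Longrightarrow> L = {0}"
    and one_mem: "\<exists>L\<in>\<L>. 1 \<in> L"
begin

definition U :: "nat \<Rightarrow> nat set" where
  "U k = \<Union>{L \<in> \<L>. k \<in> L}"

lemma U_iff: "l \<in> U k \<longleftrightarrow> (\<exists>L\<in>\<L>. k \<in> L \<and> l \<in> L)"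
  by (auto simp: U_def)

lemma U_sym: "l \<in> U k \<Longrightarrow> k \<in> U l"
  by (auto simp: U_iff)

lemma U_add: "\<lbrakk>l \<in> U k; l' \<in> U k'\<rbrakk> \<Longrightarrow> l + l' \<in> U (k + k')"
  by (meson add_closed U_iff)

lemma U_mult: "l \<in> U k \<Longrightarrow> q * l \<in> U (q * k)"
proof (induction q)
  case 0
  then show ?case using zero_mem by (auto simp: U_iff)
qed (auto intro: U_add)

lemma U_refl: "k \<in> U k"
  using U_mult[of 1 1 k] one_mem by (auto simp: U_iff)

abbreviation \<Delta> :: "nat set" where
  "\<Delta> \<equiv> \<Union>L\<in>\<L>. delta_set L"

text \<open>Write \<open>d' = q * d + r\<close> with \<open>r < d\<close>. One jump up by
  \<open>d'\<close> combined with \<open>q\<close> jumps down by \<open>d\<close> puts two lengths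
  with difference \<open>r\<close> into one set, so \<open>r > 0\<close> would yield a distance
  below the minimum \<open>d\<close>.\<close>

lemma Min_Delta_dvd:
  assumes "d \<in> \<Delta>" "\<And>e. e \<in> \<Delta> \<Longrightarrow> d \<le> e" "d' \<in> \<Delta>"
  shows "d dvd d'"
proof (rule ccontr)
  assume "\<not> d dvd d'"
  then have r: "d' mod d > 0" by (simp add: dvd_eq_mod_eq_0)
  obtain x y where x: "x + d \<in> U x" and y: "y + d' \<in> U y" and d: "d \<ge> 1"
    using assms(1,3) by (auto simp: delta_set_def U_iff)
  define q where "q = d' div d"
  have "q * x + (y + d') \<in> U (q * (x + d) + y)"
    using U_add[OF U_sym[OF U_mult[OF x, of q]] y] .
  then obtain L where L: "L \<in> \<L>" "q * (x + d) + y \<in> L" "q * x + (y + d') \<in> L"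
    by (auto simp: U_iff)
  have eq: "d' = q * d + d' mod d" by (simp add: q_def)
  then have "q * x + (y + d') = q * (x + d) + y + d' mod d" by (simp add: algebra_simps)
  with L(3) have L': "q * (x + d) + y + d' mod d \<in> L" by simp
  obtain e where e: "e \<in> delta_set L" "e \<le> d' mod d"
    using delta_set_next[OF L(2) L'] r by auto
  moreover have "d' mod d < d" using d by simp
  ultimately show False using assms(2)[of e] L by fastforce
qed

text \<open>Of \<open>q\<close> factors with lengths \<open>x\<close> and \<open>x + d\<close>, let
  \<open>i\<close> contribute the longer one.\<close>

lemma U_interval:
  assumes x: "x + d \<in> U x" and "i \<le> q"
  shows "q * x + i * d \<in> U (q * x)"
proof -
  have "i * (x + d) + (q - i) * x \<in> U (i * x + (q - i) * x)"
    using U_add[OF U_mult[OF x] U_refl] .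
  moreover have "i * x + (q - i) * x = q * x"
    using assms(2) by (simp flip: add_mult_distrib)
  moreover have "i * (x + d) + (q - i) * x = (i * x + (q - i) * x) + i * d"
    by (simp add: add_mult_distrib2)
  ultimately show ?thesis by simp
qed

text \<open>
  The interval of progression \<open>D * x + {0, d, \<dots>, D * d}\<close> inside \<open>U (D * x)\<close> bridges all
  gaps of \<open>U n\<close>.
\<close>

lemma U_fill_above:
  assumes x: "x + d \<in> U x" and "d \<ge> 1"
    and dvd: "\<And>e. e \<in> \<Delta> \<Longrightarrow> d dvd e" and D: "\<And>e. e \<in> \<Delta> \<Longrightarrow> e \<le> D"
    and m: "m \<in> U n"
    and t: "n + D * x \<le> t" "t \<le> m + D * x" "int d dvd int t - int (n + D * x)"
  shows "t \<in> U (n + D * x)"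
proof -
  \<comment> \<open>After the shift, \<open>s\<close> lies between \<open>n\<close> and
    \<open>m\<close>, two members of one set \<open>L\<close> whose gaps are at most
    \<open>D\<close>.\<close>
  define s where "s = t - D * x"
  have s: "n \<le> s" "s \<le> m" "t = s + D * x" using t by (auto simp: s_def)
  obtain L where L: "L \<in> \<L>" "n \<in> L" "m \<in> L" using m by (auto simp: U_iff)
  have LD: "e \<le> D" "d dvd e" if "e \<in> delta_set L" for e using that D dvd L by blast+
  obtain p where p: "p \<in> L" "p \<le> s" "s \<le> p + D"
    using delta_set_gap_bound[OF LD(1) L(2,3) s(1,2)] by blast
  have "int d dvd int p - int n"
    using LD(2) L(2) p(1) by (rule delta_set_dvd_diff)
  with t(3) have "int d dvd (int t - int (n + D * x)) - (int p - int n)" by (rule dvd_diff)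
  also have "\<dots> = int (s - p)" using s p by simp
  finally have "d dvd s - p" by simp
  then obtain i where i: "s - p = i * d" by (metis dvdE mult.commute)
  \<comment> \<open>The remaining difference \<open>i * d\<close> is at most \<open>D\<close>, so
    \<open>i\<close> is in the range of \<open>U_interval\<close> with \<open>q = D\<close>.\<close>
  have "i \<le> i * d" using \<open>d \<ge> 1\<close> by simp
  then have "i \<le> D" using i p by linarith
  then have "p + (D * x + i * d) \<in> U (n + D * x)"
    using p L by (intro U_add U_interval[OF x]) (auto simp: U_iff)
  moreover have "t = p + (D * x + i * d)" using i s p by simp
  ultimately show ?thesis by simp
qed

lemma U_eq_singleton:
  assumes "\<Delta> = {}"
  shows "U k = {k}"
proof -
  have "l = k" if l: "l \<in> U k" for l
  proof (rule ccontr)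
    assume "l \<noteq> k"
    obtain L where L: "L \<in> \<L>" "k \<in> L" "l \<in> L" using l by (auto simp: U_iff)
    then have "delta_set L = {}" using assms by auto
    then show False
      using L \<open>l \<noteq> k\<close> delta_set_next[of k L l] delta_set_next[of l L k] by (cases "k < l") auto
  qed
  then show ?thesis using U_refl by blast
qed

text \<open>\<open>step\<close> expresses \<open>sup U(k+1) \<le> sup U(k) + K\<close> through
  members.\<close>

theorem structure_theorem:
  assumes fin_Delta: "finite \<Delta>"
    and fin: "\<And>k. k \<ge> 1 \<Longrightarrow> finite (U k)"
    and step: "\<And>k l. \<lbrakk>k \<ge> 1; l \<in> U (k + 1)\<rbrakk> \<Longrightarrow> \<exists>l'\<in>U k. l \<le> l' + K"
  shows "\<exists>d\<ge>1. \<exists>M. \<exists>k0. \<forall>k\<ge>k0. is_AAP d M (U k)"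
proof (cases "\<Delta> = {}")
  case True
  then show ?thesis using is_AAP_singleton U_eq_singleton by (metis order_refl)
next
  case False
  define d where "d = Min \<Delta>"
  define D where "D = Max \<Delta>"
  have d_mem: "d \<in> \<Delta>" and d_min: "\<And>e. e \<in> \<Delta> \<Longrightarrow> d \<le> e" and D: "\<And>e. e \<in> \<Delta> \<Longrightarrow> e \<le> D"
    using Min_in[OF fin_Delta False] Min_le[OF fin_Delta] Max_ge[OF fin_Delta]
    unfolding d_def D_def by blast+
  have dvd: "d dvd e" if "e \<in> \<Delta>" for e using Min_Delta_dvd[OF d_mem d_min that] .
  have "d \<ge> 1" using d_mem by (auto simp: delta_set_def)
  obtain x where x: "x + d \<in> U x"
    using d_mem by (auto simp: delta_set_def U_iff)
  \<comment> \<open>\<open>D * x * K\<close> pays for the growth of the maximum from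
    \<open>U (k - D * x)\<close> to \<open>U k\<close>; \<open>D * x + 1\<close> keeps
    \<open>k - D * x\<close> positive for \<open>k \<ge> M\<close>.\<close>
  define M where "M = D * x * K + D * x + 1"
  have Max_mem: "Max (U k) \<in> U k" and Max_upper: "\<And>l. l \<in> U k \<Longrightarrow> l \<le> Max (U k)"
    and Min_mem: "Min (U k) \<in> U k" if "k \<ge> 1" for k
    using fin[OF that] U_refl[of k] by (auto intro: Max_in Min_in)
  have cls: "int d dvd int l - int k" if l: "l \<in> U k" for k l
  proof -
    obtain L where "L \<in> \<L>" "k \<in> L" "l \<in> L" using l by (auto simp: U_iff)
    then show ?thesis using dvd by (intro delta_set_dvd_diff[of L]) auto
  qed
  have steps: "Max (U (n + j)) \<le> Max (U n) + j * K" if "n \<ge> 1" for n j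
  proof (induction j)
    case (Suc j)
    have "n + j \<ge> 1" using that by simp
    then obtain l where "l \<in> U (n + j)" "Max (U (n + j + 1)) \<le> l + K"
      using step[OF _ Max_mem[of "n + j + 1"]] by auto
    then have "Max (U (n + j + 1)) \<le> Max (U (n + j)) + K"
      using Max_upper[OF \<open>n + j \<ge> 1\<close>, of l] by linarith
    then show ?case using Suc by simp
  qed auto
  have above: "t \<in> U k" if t: "k \<ge> M" "k \<le> t" "t + M \<le> Max (U k)" "int d dvd int t - int k" for k t
  proof -
    define n where "n = k - D * x"
    have k: "k = n + D * x" "n \<ge> 1" using t(1) by (auto simp: n_def M_def)
    \<comment> \<open>The margin \<open>M\<close> at the top brings \<open>t\<close> into the range
      of \<open>U_fill_above\<close> for \<open>n\<close> and its largest partner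
      \<open>Max (U n)\<close>.\<close>
    have "t \<le> Max (U n) + D * x"
      using t(3) steps[OF k(2), of "D * x"] unfolding k(1) M_def by simp
    with t k show ?thesis
      using U_fill_above[OF x \<open>d \<ge> 1\<close> dvd D Max_mem[OF k(2)]] by auto
  qed
  text \<open>
    By symmetry of the relation \<open>l \<in> U k\<close>, filling below \<open>k\<close> amounts to filling above \<open>t\<close>;
    there \<open>Min (U k) + M \<le> t\<close> forces \<open>k + M \<le> Max (U t)\<close>.
  \<close>
  have below: "t \<in> U k" if t: "k \<ge> 1" "t \<le> k" "Min (U k) + M \<le> t" "int d dvd int t - int k" for k t
  proof -
    have t1: "t \<ge> 1" using t(3) by (simp add: M_def)
    have "k + (t - Min (U k)) \<in> U (Min (U k) + (t - Min (U k)))"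
      by (intro U_add U_refl U_sym[OF Min_mem[OF t(1)]])
    then have "k + (t - Min (U k)) \<in> U t" using t(3) by simp
    then have "k + (t - Min (U k)) \<le> Max (U t)" using t1 by (rule Max_upper[rotated])
    then have "k + M \<le> Max (U t)" using t(3) by linarith
    moreover have "int d dvd int k - int t" using t(4) by (simp add: dvd_diff_commute)
    ultimately have "k \<in> U t" using t by (intro above) auto
    then show ?thesis by (rule U_sym)
  qed
  have "is_AAP d M (U k)" if k: "k \<ge> M * (x + d) + M" for k
  proof (rule is_AAP_finiteI[where k = k])
    have k1: "k \<ge> 1" using k by (simp add: M_def)
    show "finite (U k)" "k \<in> U k" "d \<ge> 1" using fin k1 U_refl \<open>d \<ge> 1\<close> by auto
    \<comment> \<open>\<open>k\<close> consists of \<open>M\<close> copies of \<open>x + d\<close>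
      and a rest \<open>r\<close>. Exchanging each \<open>x + d\<close> for \<open>x\<close>
      produces a member \<open>M * d\<close> below \<open>k\<close>, which leaves the margin
      \<open>M\<close> above \<open>Min (U k)\<close>.\<close>
    define r where "r = k - M * (x + d)"
    have kr: "k = M * (x + d) + r" using k by (simp add: r_def)
    have "M * x + r \<in> U k"
      unfolding kr by (intro U_add U_refl U_mult U_sym[OF x])
    then have "Min (U k) \<le> M * x + r" using fin[OF k1] by auto
    moreover have "M \<le> M * d" using \<open>d \<ge> 1\<close> by simp
    moreover have "k = M * x + r + M * d" by (simp add: kr algebra_simps)
    ultimately show "Min (U k) + M \<le> k" by linarith
    \<comment> \<open>Now \<open>k\<close> is read as \<open>M\<close> copies of \<open>x\<close>
      and a rest, and the exchange goes upwards.\<close>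
    have "M * (x + d) + (r + M * d) \<in> U (M * x + (r + M * d))"
      by (intro U_add U_refl U_mult x)
    then have "k + M * d \<in> U k" by (simp add: kr algebra_simps)
    then have "k + M * d \<le> Max (U k)" by (rule Max_upper[OF k1])
    with \<open>M \<le> M * d\<close> show "k + M \<le> Max (U k)" by linarith
    show "int d dvd int l - int k" if "l \<in> U k" for l using cls[OF that] .
    show "t \<in> U k" if "int d dvd int t - int k" "Min (U k) + M \<le> t" "t + M \<le> Max (U k)" for t
      using above[of k t] below[of k t] that k k1 by (cases "k \<le> t") auto
  qed
  then show ?thesis using \<open>d \<ge> 1\<close> by blast
qed

text \<open>\<open>bound\<close> says \<open>l / k \<le> m / n\<close> without fractions. The
  witness combines \<open>q\<close> copies of the extremal pair \<open>n\<close>, \<open>m\<close>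
  with \<open>r\<close> lengths left unchanged.\<close>

lemma Sup_U_Suc_le:
  assumes "m \<in> U n" "n \<ge> 1"
    and bound: "\<And>k l. l \<in> U k \<Longrightarrow> l * n \<le> k * m"
    and "l \<in> U (k + 1)"
  shows "\<exists>l'\<in>U k. l \<le> l' + m"
proof
  define q r where "q = k div n" and "r = k mod n"
  have k: "k = q * n + r" and "r < n" using assms(2) by (auto simp: q_def r_def)
  show "q * m + r \<in> U k" unfolding k by (intro U_add U_mult U_refl assms)
  have "l * n \<le> (k + 1) * m" using assms by blast
  \<comment> \<open>Here \<open>r < n\<close> enters as \<open>k + 1 \<le> (q + 1) * n\<close>, so
    one further \<open>m\<close> suffices.\<close>
  also have "\<dots> \<le> (q * n + n) * m" using \<open>r < n\<close> k by (intro mult_le_mono) auto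
  also have "\<dots> = ((q + 1) * m) * n" by (simp add: algebra_simps)
  finally have "l \<le> (q + 1) * m" using assms(2) by simp
  then show "l \<le> q * m + r + m" by simp
qed

end

section \<open>Elasticity of sets of lengths\<close>

lemma SUP_enat_eq_Max:
  assumes "finite A" "A \<noteq> {}"
  shows "(SUP l\<in>A. enat l) = enat (Max A)"
  using assms by (intro antisym SUP_upper SUP_least) auto

lemma ennreal_of_nat_divide:
  "k \<ge> 1 \<Longrightarrow> (of_nat l / of_nat k :: ennreal) = ennreal (real l / real k)"
  by (simp add: ennreal_of_nat_eq_real_of_nat divide_ennreal)

text \<open>Only positive lengths enter the definition, so \<open>l = 0\<close> is treated apart;
  otherwise \<open>Inf P \<le> k\<close> and \<open>l\<close> is at most the supremum.\<close>

lemma ratio_le_elasticity_of_set: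
  assumes "k \<in> L" "l \<in> L" "k \<ge> 1"
  shows "of_nat l / of_nat k \<le> elasticity_of_set L"
proof (cases "l \<ge> 1")
  case True
  define P where "P = {k \<in> L. k \<ge> 1}"
  have P: "k \<in> P" "l \<in> P" using assms True by (auto simp: P_def)
  have "Inf P \<in> P" using P by (intro Inf_nat_def1) auto
  then have pos: "Inf P \<ge> 1" by (simp add: P_def)
  have "Inf P \<le> k" using P by (intro cInf_lower) auto
  then have "of_nat l / of_nat k \<le> (of_nat l / of_nat (Inf P) :: ennreal)"
    using pos assms(3) by (simp add: ennreal_of_nat_divide frac_le ennreal_leI)
  also have "(of_nat l / of_nat (Inf P) :: ennreal) = ennreal_of_enat (enat l) / of_nat (Inf P)"
    by simp
  also have "\<dots> \<le> ennreal_of_enat (SUP k\<in>P. enat k) / of_nat (Inf P)"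
    using SUP_upper[OF P(2), of enat]
    by (intro divide_right_mono_ennreal) (simp only: ennreal_of_enat_le_iff)
  also have "\<dots> = elasticity_of_set L"
    using P by (auto simp: elasticity_of_set_def Let_def P_def)
  finally show ?thesis .
next
  case False
  then have "l = 0" by simp
  then show ?thesis by simp
qed

text \<open>A finite quotient forces finitely many positive lengths, whose maximum and minimum serve
  as \<open>m\<close> and \<open>n\<close>. The pair \<open>1\<close>, \<open>1\<close> represents
  the default value \<open>1\<close>.\<close>

lemma elasticity_of_set_attained:
  assumes "elasticity_of_set L < \<infinity>"
  obtains n m where "n \<ge> 1" "elasticity_of_set L = of_nat m / of_nat n"
    "n \<in> L \<and> m \<in> L \<or> n = 1 \<and> m = 1"
proof (cases "{k \<in> L. k \<ge> 1} = {}")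
  case True
  then have "elasticity_of_set L = 1" unfolding elasticity_of_set_def by simp
  with that[of 1 1] show ?thesis by simp
next
  case False
  define P where "P = {k \<in> L. k \<ge> 1}"
  have eq: "elasticity_of_set L = ennreal_of_enat (SUP k\<in>P. enat k) / of_nat (Inf P)"
    using False by (simp add: elasticity_of_set_def Let_def P_def)
  have "(SUP k\<in>P. enat k) \<noteq> \<infinity>"
  proof
    assume "(SUP k\<in>P. enat k) = \<infinity>"
    then have "elasticity_of_set L = \<infinity>" by (simp add: eq ennreal_top_divide)
    with assms show False by simp
  qed
  then obtain b where b: "(SUP k\<in>P. enat k) = enat b" by auto
  have "k \<le> b" if "k \<in> P" for k using SUP_upper[OF that, of enat] b by simp
  then have "finite P" by (intro finite_subset[of P "{..b}"]) auto
  then have "(SUP k\<in>P. enat k) = enat (Max P)" "Max P \<in> P"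
    using SUP_enat_eq_Max[of P] Max_in[of P] False unfolding P_def by blast+
  moreover have "Inf P \<in> P" using False unfolding P_def by (intro Inf_nat_def1) auto
  ultimately show ?thesis
    using that[of "Inf P" "Max P"] eq by (auto simp: P_def)
qed

text \<open>\<open>N \<ge> 1\<close> covers the default value \<open>1\<close> of sets without
  positive elements.\<close>

lemma elasticity_of_set_le:
  assumes "\<And>k l. \<lbrakk>k \<in> L; l \<in> L; k \<ge> 1\<rbrakk> \<Longrightarrow> l \<le> k * N" "N \<ge> 1"
  shows "elasticity_of_set L \<le> of_nat N"
proof (cases "{k \<in> L. k \<ge> 1} = {}")
  case True
  then show ?thesis using assms(2) by (simp add: elasticity_of_set_def)
next
  case False
  define P where "P = {k \<in> L. k \<ge> 1}"
  have inf: "Inf P \<in> P" using False unfolding P_def by (intro Inf_nat_def1) auto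
  then have "(SUP k\<in>P. enat k) \<le> enat (Inf P * N)"
    using assms(1) by (intro SUP_least) (auto simp: P_def)
  then have "ennreal_of_enat (SUP k\<in>P. enat k) / of_nat (Inf P) \<le>
      ennreal_of_enat (enat (Inf P * N)) / of_nat (Inf P)"
    by (intro divide_right_mono_ennreal) (simp only: ennreal_of_enat_le_iff)
  also have "\<dots> = of_nat (Inf P * N) / of_nat (Inf P)" by simp
  also have "\<dots> = of_nat N"
    using inf by (subst ennreal_of_nat_divide) (auto simp: P_def ennreal_of_nat_eq_real_of_nat)
  finally show ?thesis using False by (simp add: elasticity_of_set_def Let_def P_def)
qed

section \<open>Products over multisets\<close>

text \<open>The body is that of \<open>factorization_prod\<close> with the monoid as a parameter, so
  that it serves both for a monoid and for its reduced monoid.\<close>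

definition mset_prod :: "('a, 'b) monoid_scheme \<Rightarrow> 'a multiset \<Rightarrow> 'a" where
  "mset_prod G z = (\<Otimes>\<^bsub>G\<^esub>u\<in>set_mset z. u [^]\<^bsub>G\<^esub> count z u)"

context comm_monoid
begin

text \<open>Additional indices carry exponent \<open>0\<close>. Products of different multisets can
  thus be compared over one index set.\<close>

lemma mset_prod_superset:
  assumes "finite B" "set_mset z \<subseteq> B" "B \<subseteq> carrier G"
  shows "mset_prod G z = (\<Otimes>u\<in>B. u [^] count z u)"
  unfolding mset_prod_def using assms
  by (intro finprod_mono_neutral_cong_left) (auto simp: not_in_iff)

lemma mset_prod_empty [simp]: "mset_prod G {#} = \<one>"
  by (simp add: mset_prod_def)

lemma mset_prod_closed [simp, intro]: "set_mset z \<subseteq> carrier G \<Longrightarrow> mset_prod G z \<in> carrier G"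
  unfolding mset_prod_def by (intro finprod_closed) auto

lemma mset_prod_add_mset [simp]:
  assumes "x \<in> carrier G" "set_mset z \<subseteq> carrier G"
  shows "mset_prod G (add_mset x z) = x \<otimes> mset_prod G z"
proof -
  \<comment> \<open>With \<open>x\<close> split off, the two products differ only in the exponent of
    \<open>x\<close>, whether or not \<open>x\<close> occurs in \<open>z\<close>.\<close>
  define A where "A = set_mset z - {x}"
  have A: "finite A" "x \<notin> A" "A \<subseteq> carrier G" and B: "insert x (set_mset z) = insert x A"
    using assms by (auto simp: A_def)
  have "mset_prod G (add_mset x z) = (\<Otimes>u\<in>insert x A. u [^] count (add_mset x z) u)"
    using A assms B by (intro mset_prod_superset) auto
  also have "\<dots> = x [^] Suc (count z x) \<otimes> (\<Otimes>u\<in>A. u [^] count (add_mset x z) u)"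
    using A assms by (subst finprod_insert) auto
  also have "(\<Otimes>u\<in>A. u [^] count (add_mset x z) u) = (\<Otimes>u\<in>A. u [^] count z u)"
    using A by (intro finprod_cong') auto
  also have "x [^] Suc (count z x) \<otimes> \<dots> = x \<otimes> (x [^] count z x \<otimes> (\<Otimes>u\<in>A. u [^] count z u))"
  proof -
    have "(\<Otimes>u\<in>A. u [^] count z u) \<in> carrier G" using A by (intro finprod_closed) auto
    then show ?thesis using assms nat_pow_Suc2[of x "count z x"] by (simp add: m_assoc del: nat_pow_Suc)
  qed
  also have "x [^] count z x \<otimes> (\<Otimes>u\<in>A. u [^] count z u) = (\<Otimes>u\<in>insert x A. u [^] count z u)"
    using A assms by (subst finprod_insert) auto
  also have "\<dots> = mset_prod G z"
    using A assms B by (intro mset_prod_superset[symmetric]) auto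
  finally show ?thesis .
qed

lemma mset_prod_union:
  "\<lbrakk>set_mset y \<subseteq> carrier G; set_mset z \<subseteq> carrier G\<rbrakk> \<Longrightarrow>
    mset_prod G (y + z) = mset_prod G y \<otimes> mset_prod G z"
  by (induction y) (auto simp: m_assoc)

lemma mset_prod_diff:
  assumes "y \<subseteq># z" "set_mset z \<subseteq> carrier G"
  shows "mset_prod G z = mset_prod G y \<otimes> mset_prod G (z - y)"
proof -
  have "set_mset y \<subseteq> carrier G" "set_mset (z - y) \<subseteq> carrier G"
    using assms set_mset_mono in_diffD by fastforce+
  then show ?thesis using assms(1) by (simp flip: mset_prod_union)
qed

text \<open>Passage from the indexed products of the definitions to multisets; repeated values of
  \<open>f\<close> become multiplicities.\<close>

lemma finprod_eq_mset_prod: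
  assumes "finite S" "f ` S \<subseteq> carrier G"
  shows "finprod G f S = mset_prod G (image_mset f (mset_set S))"
  using assms
proof (induction S rule: finite_induct)
  case (insert x S)
  then show ?case by (subst finprod_insert) auto
qed simp

end

lemma ex_indexing_mset: "\<exists>f. image_mset f (mset_set {1..size z}) = z"
proof -
  obtain xs where xs: "mset xs = z" using ex_mset by blast
  \<comment> \<open>The list is numbered from \<open>0\<close>, the index range from
    \<open>1\<close>.\<close>
  have "map (\<lambda>i. xs ! (i - 1)) [1..<Suc (length xs)] = xs"
    by (intro nth_equalityI) (auto simp del: upt_Suc)
  moreover have "mset_set {1..length xs} = mset [1..<Suc (length xs)]"
    by (metis atLeastLessThanSuc_atLeastAtMost mset_upt)
  ultimately have "image_mset (\<lambda>i. xs ! (i - 1)) (mset_set {1..length xs}) = mset xs"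
    by (metis mset_map)
  then show ?thesis using xs by auto
qed

lemma (in comm_monoid) product_of_atoms_iff:
  "product_of_atoms G k a \<longleftrightarrow> (\<exists>z. set_mset z \<subseteq> atoms G \<and> size z = k \<and> mset_prod G z = a)"
proof
  assume "product_of_atoms G k a"
  then obtain p where p: "\<forall>i\<in>{1..k}. p i \<in> atoms G" "a = finprod G p {1..k}"
    by (auto simp: product_of_atoms_def)
  then have "a = mset_prod G (image_mset p (mset_set {1..k}))"
    by (subst finprod_eq_mset_prod[symmetric]) (auto simp: atoms_def)
  then show "\<exists>z. set_mset z \<subseteq> atoms G \<and> size z = k \<and> mset_prod G z = a"
    using p(1) by (intro exI[of _ "image_mset p (mset_set {1..k})"]) auto
next
  assume "\<exists>z. set_mset z \<subseteq> atoms G \<and> size z = k \<and> mset_prod G z = a"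
  then obtain z where z: "set_mset z \<subseteq> atoms G" "size z = k" "mset_prod G z = a" by blast
  obtain p where p: "image_mset p (mset_set {1..k}) = z" using ex_indexing_mset z(2) by blast
  then have pz: "p ` {1..k} = set_mset z" by (metis finite_atLeastAtMost finite_set_mset_mset_set set_image_mset)
  then have "finprod G p {1..k} = a"
    using z p by (subst finprod_eq_mset_prod) (auto simp: atoms_def)
  then show "product_of_atoms G k a"
    unfolding product_of_atoms_def using pz z(1) by (intro exI[of _ p]) auto
qed

text \<open>
  For \<open>n = 0\<close> the subset condition is trivial, so that the restriction to \<open>n \<ge> 1\<close> in
  \<^const>\<open>omega_at\<close> is harmless.
\<close>

lemma (in comm_monoid) omega_at_mset:
  assumes "omega_at G a \<le> enat N" "set_mset w \<subseteq> carrier G" "a divides mset_prod G w"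
  obtains s where "s \<subseteq># w" "size s \<le> N" "a divides mset_prod G s"
proof (cases "w = {#}")
  case True
  with assms(3) that[of "{#}"] show ?thesis by simp
next
  case False
  define P where "P M \<longleftrightarrow> (\<forall>n\<ge>1::nat. \<forall>b. (\<forall>i\<in>{1..n}. b i \<in> carrier G) \<longrightarrow>
        a divides (\<Otimes>i\<in>{1..n}. b i) \<longrightarrow>
        (\<exists>S\<subseteq>{1..n}. enat (card S) \<le> M \<and> a divides (\<Otimes>i\<in>S. b i)))" for M
  \<comment> \<open>The full index set is a witness for \<open>\<infinity>\<close>. As
    \<open>enat\<close> is well-ordered, the least admissible value is then itself
    admissible.\<close>
  have "P \<infinity>" unfolding P_def by auto
  then have P: "P (omega_at G a)"
    unfolding omega_at_def P_def[symmetric] by (rule LeastI)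
  obtain b where b: "image_mset b (mset_set {1..size w}) = w" using ex_indexing_mset by blast
  then have bw: "b ` {1..size w} = set_mset w" by (metis finite_atLeastAtMost finite_set_mset_mset_set set_image_mset)
  have "(\<Otimes>i\<in>{1..size w}. b i) = mset_prod G w"
    using assms bw b by (subst finprod_eq_mset_prod) auto
  moreover have "\<forall>i\<in>{1..size w}. b i \<in> carrier G" using bw assms(2) by blast
  moreover have "size w \<ge> 1" using False by (simp add: Suc_le_eq nonempty_has_size)
  ultimately obtain S where S: "S \<subseteq> {1..size w}" "enat (card S) \<le> omega_at G a"
      "a divides (\<Otimes>i\<in>S. b i)"
    using P assms(3) unfolding P_def by (metis (no_types, lifting))
  have "finite S" using S(1) finite_subset by blast
  show ?thesis
  proof (rule that)
    have "image_mset b (mset_set S) \<subseteq># image_mset b (mset_set {1..size w})"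
      using S(1) by (intro image_mset_subseteq_mono subset_imp_msubset_mset_set) auto
    then show "image_mset b (mset_set S) \<subseteq># w" using b by simp
    show "size (image_mset b (mset_set S)) \<le> N"
      using order_trans[OF S(2) assms(1)] by simp
    show "a divides mset_prod G (image_mset b (mset_set S))"
      using S \<open>finite S\<close> bw assms(2) by (subst finprod_eq_mset_prod[symmetric]) auto
  qed
qed

section \<open>The associated reduced monoid\<close>

context comm_monoid
begin

abbreviation cls :: "'a \<Rightarrow> 'a set" where
  "cls a \<equiv> a <# Units G"

abbreviation R :: "'a set monoid" where
  "R \<equiv> reduced_monoid G"

lemma cls_alt: "cls a = (\<lambda>u. a \<otimes> u) ` Units G"
  by (auto simp: l_coset_def)

lemma cls_mult_unit:
  assumes "a \<in> carrier G" "u \<in> Units G"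
  shows "cls (a \<otimes> u) = cls a"
proof -
  have "(a \<otimes> u) \<otimes> v \<in> cls a" if "v \<in> Units G" for v
    using assms that by (auto simp: cls_alt m_assoc Units_closed)
  moreover have "a \<otimes> v \<in> cls (a \<otimes> u)" if v: "v \<in> Units G" for v
  proof -
    have "u \<otimes> (inv u \<otimes> v) = v"
      using assms v by (simp add: Units_closed m_assoc[symmetric])
    then have "a \<otimes> v = (a \<otimes> u) \<otimes> (inv u \<otimes> v)"
      using assms v by (simp add: Units_closed m_assoc)
    then show ?thesis using assms v by (auto simp: cls_alt)
  qed
  ultimately show ?thesis by (auto simp: cls_alt)
qed

lemma cls_eq_iff:
  assumes "a \<in> carrier G" "b \<in> carrier G"
  shows "cls a = cls b \<longleftrightarrow> (\<exists>u\<in>Units G. b = a \<otimes> u)"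
proof
  assume "cls a = cls b"
  moreover have "b \<in> cls b" using assms r_one[of b] by (force simp: cls_alt)
  ultimately show "\<exists>u\<in>Units G. b = a \<otimes> u" by (auto simp: cls_alt)
qed (auto simp: cls_mult_unit assms)

lemma cls_set_mult:
  assumes "a \<in> carrier G" "b \<in> carrier G"
  shows "cls a <#> cls b = cls (a \<otimes> b)"
proof -
  have *: "(a \<otimes> u) \<otimes> (b \<otimes> v) = (a \<otimes> b) \<otimes> (u \<otimes> v)" if "u \<in> Units G" "v \<in> Units G" for u v
    using assms that by (simp add: Units_closed m_ac)
  have "(a \<otimes> b) \<otimes> u = (a \<otimes> u) \<otimes> (b \<otimes> \<one>)" if "u \<in> Units G" for u
    using assms that by (simp add: Units_closed m_ac)
  then have "cls (a \<otimes> b) \<subseteq> cls a <#> cls b" unfolding cls_alt set_mult_def by blast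
  moreover have "cls a <#> cls b \<subseteq> cls (a \<otimes> b)" using * by (auto simp: cls_alt set_mult_def)
  ultimately show ?thesis by blast
qed

lemma cls_one: "cls \<one> = Units G"
  by (auto simp: cls_alt Units_closed intro: rev_image_eqI)

lemma carrier_R: "carrier R = cls ` carrier G"
  and one_R: "\<one>\<^bsub>R\<^esub> = cls \<one>"
  and mult_R: "\<lbrakk>a \<in> carrier G; b \<in> carrier G\<rbrakk> \<Longrightarrow> cls a \<otimes>\<^bsub>R\<^esub> cls b = cls (a \<otimes> b)"
  by (simp_all add: reduced_monoid_def cls_set_mult) (simp add: cls_one)

lemma comm_monoid_R: "comm_monoid R"
proof (rule comm_monoidI)
  fix x y z assume "x \<in> carrier R" "y \<in> carrier R" "z \<in> carrier R"
  then obtain a b c where abc: "a \<in> carrier G" "b \<in> carrier G" "c \<in> carrier G"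
    and [simp]: "x = cls a" "y = cls b" "z = cls c"
    by (auto simp: carrier_R)
  show "x \<otimes>\<^bsub>R\<^esub> y \<in> carrier R" "x \<otimes>\<^bsub>R\<^esub> y = y \<otimes>\<^bsub>R\<^esub> x"
    "x \<otimes>\<^bsub>R\<^esub> y \<otimes>\<^bsub>R\<^esub> z = x \<otimes>\<^bsub>R\<^esub> (y \<otimes>\<^bsub>R\<^esub> z)"
    using abc by (simp_all add: mult_R carrier_R m_ac)
  show "\<one>\<^bsub>R\<^esub> \<otimes>\<^bsub>R\<^esub> x = x" using abc by (simp add: one_R mult_R)
qed (simp add: carrier_R one_R)

lemma cls_eq_one_iff: "a \<in> carrier G \<Longrightarrow> cls a = \<one>\<^bsub>R\<^esub> \<longleftrightarrow> a \<in> Units G"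
  using cls_eq_iff[of "\<one>" a] by (metis Units_closed l_one one_R one_closed)

lemma Units_R: "Units R = {\<one>\<^bsub>R\<^esub>}"
proof -
  interpret R: comm_monoid R by (rule comm_monoid_R)
  have "x = \<one>\<^bsub>R\<^esub>" if x: "x \<in> Units R" for x
  proof -
    obtain y where "x \<in> carrier R" "y \<in> carrier R" "x \<otimes>\<^bsub>R\<^esub> y = \<one>\<^bsub>R\<^esub>"
      using x by (auto simp: Units_def)
    then obtain a b where ab: "a \<in> carrier G" "b \<in> carrier G" "x = cls a" "cls (a \<otimes> b) = \<one>\<^bsub>R\<^esub>"
      by (auto simp: carrier_R mult_R)
    then have "a \<otimes> b \<in> Units G" by (simp add: cls_eq_one_iff)
    then have "a \<in> Units G" using ab unit_factor by blast
    then show ?thesis using ab by (simp add: cls_eq_one_iff)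
  qed
  then show ?thesis by auto
qed

lemma divides_R_iff:
  assumes "a \<in> carrier G" "b \<in> carrier G"
  shows "cls a divides\<^bsub>R\<^esub> cls b \<longleftrightarrow> a divides b"
proof
  assume "cls a divides\<^bsub>R\<^esub> cls b"
  then obtain c where c: "c \<in> carrier G" "cls b = cls (a \<otimes> c)"
    using assms by (auto simp: factor_def carrier_R mult_R)
  then obtain u where "u \<in> Units G" "b = a \<otimes> c \<otimes> u"
    using assms by (metis cls_eq_iff m_closed)
  then show "a divides b"
    using assms c by (auto simp: factor_def m_assoc Units_closed intro!: bexI[of _ "c \<otimes> u"])
next
  assume "a divides b"
  then show "cls a divides\<^bsub>R\<^esub> cls b"
    using assms by (auto simp: factor_def carrier_R mult_R)
qed

lemma atoms_closed: "p \<in> atoms G \<Longrightarrow> p \<in> carrier G"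
  by (simp add: atoms_def)

text \<open>Equal classes agree up to a unit, and moving this unit into the second factor does not
  affect whether that factor is a unit.\<close>

lemma cls_mem_atoms_iff:
  assumes "p \<in> carrier G"
  shows "cls p \<in> atoms R \<longleftrightarrow> p \<in> atoms G"
proof -
  have "cls p \<in> atoms R \<longleftrightarrow> p \<notin> Units G \<and>
      (\<forall>a\<in>carrier G. \<forall>b\<in>carrier G. cls p = cls (a \<otimes> b) \<longrightarrow> a \<in> Units G \<or> b \<in> Units G)"
    using assms by (auto simp: atoms_def Units_R cls_eq_one_iff carrier_R mult_R)
  also have "\<dots> \<longleftrightarrow> p \<in> atoms G"
  proof -
    have "a \<in> Units G \<or> b \<in> Units G"
      if p: "p \<in> atoms G" and ab: "a \<in> carrier G" "b \<in> carrier G" "cls p = cls (a \<otimes> b)" for a b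
    proof -
      obtain u where u: "u \<in> Units G" "p = a \<otimes> (b \<otimes> u)"
        using ab assms by (metis cls_eq_iff m_closed m_assoc Units_closed)
      then have "a \<in> Units G \<or> b \<otimes> u \<in> Units G"
        using p ab by (auto simp: atoms_def Units_closed)
      then show ?thesis using ab u unit_factor Units_closed by blast
    qed
    then show ?thesis using assms by (auto simp: atoms_def)
  qed
  finally show ?thesis .
qed

lemma atoms_R: "atoms R = cls ` atoms G"
proof -
  have "atoms R \<subseteq> cls ` carrier G" unfolding carrier_R[symmetric] by (auto simp: atoms_def)
  then show ?thesis using cls_mem_atoms_iff atoms_closed by auto
qed

lemma mset_prod_R:
  "set_mset z \<subseteq> carrier G \<Longrightarrow> mset_prod R (image_mset cls z) = cls (mset_prod G z)"
proof (induction z)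
  case empty
  interpret R: comm_monoid R by (rule comm_monoid_R)
  show ?case by (simp add: one_R)
next
  case (add x z)
  interpret R: comm_monoid R by (rule comm_monoid_R)
  have "cls x \<in> carrier R" "set_mset (image_mset cls z) \<subseteq> carrier R"
    using add.prems by (auto simp: carrier_R)
  then have "mset_prod R (image_mset cls (add_mset x z)) = cls x \<otimes>\<^bsub>R\<^esub> mset_prod R (image_mset cls z)"
    by simp
  then show ?case using add by (simp add: mult_R)
qed

section \<open>Lifting factorizations from the reduced monoid\<close>

lemma obtain_lift_mset:
  assumes "set_mset w \<subseteq> cls ` A"
  obtains v where "set_mset v \<subseteq> A" "image_mset cls v = w"
proof -
  have "\<exists>v. set_mset v \<subseteq> A \<and> image_mset cls v = w"
    using assms
  proof (induction w)
    case (add x w)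
    then obtain v a where "set_mset v \<subseteq> A" "image_mset cls v = w" "a \<in> A" "x = cls a" by auto
    then show ?case by (intro exI[of _ "add_mset a v"]) auto
  qed auto
  then show ?thesis using that by blast
qed

lemma factorizations_iff:
  "z \<in> factorizations G a \<longleftrightarrow> set_mset z \<subseteq> atoms R \<and> mset_prod R z = cls a"
  by (simp add: factorizations_def factorization_monoid_def factorization_prod_def mset_prod_def)

text \<open>
  A lift of a factorization in the reduced monoid has the right product up to a unit only; the
  unit is absorbed into one of the atoms.
\<close>

lemma length_set_eq:
  assumes a: "a \<in> carrier G"
  shows "length_set G a = size ` factorizations G a"
proof (cases "a \<in> Units G")
  case True
  interpret R: comm_monoid R by (rule comm_monoid_R)
  \<comment> \<open>Only the empty factorization represents the unit class: an atom dividing the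
    identity would be a unit.\<close>
  have "z = {#}" if z: "set_mset z \<subseteq> atoms R" "mset_prod R z = \<one>\<^bsub>R\<^esub>" for z
  proof (cases z)
    case (add x y)
    then have xy: "x \<in> atoms R" "x \<in> carrier R" "set_mset y \<subseteq> carrier R"
      using z R.atoms_closed by auto
    then have "x \<otimes>\<^bsub>R\<^esub> mset_prod R y = \<one>\<^bsub>R\<^esub>" using z add by simp
    then have "x \<in> Units R" using xy R.unit_factor[of x "mset_prod R y"] by simp
    with xy show ?thesis by (simp add: atoms_def)
  qed simp
  moreover have "cls a = \<one>\<^bsub>R\<^esub>" using True a by (simp add: cls_eq_one_iff)
  ultimately have "factorizations G a = {{#}}" by (auto simp: factorizations_iff)
  then show ?thesis using True by (simp add: length_set_def)
next
  case False
  show ?thesis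
  proof (intro equalityI subsetI)
    fix k assume "k \<in> length_set G a"
    then obtain z where z: "set_mset z \<subseteq> atoms G" "size z = k" "mset_prod G z = a"
      using False by (auto simp: length_set_def product_of_atoms_iff)
    then have "image_mset cls z \<in> factorizations G a"
      using atoms_closed by (auto simp: factorizations_iff atoms_R subset_iff mset_prod_R)
    then show "k \<in> size ` factorizations G a" using z by force
  next
    fix k assume "k \<in> size ` factorizations G a"
    then obtain z where z: "set_mset z \<subseteq> cls ` atoms G" "mset_prod R z = cls a" "size z = k"
      by (auto simp: factorizations_iff atoms_R)
    obtain v where v: "set_mset v \<subseteq> atoms G" "image_mset cls v = z"
      using obtain_lift_mset[OF z(1)] .
    have vc: "set_mset v \<subseteq> carrier G" using v atoms_closed by auto
    then have "cls (mset_prod G v) = cls a" using mset_prod_R[OF vc] v z by simp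
    then obtain u where u: "u \<in> Units G" "a = mset_prod G v \<otimes> u"
      using cls_eq_iff[OF mset_prod_closed[OF vc] a] by blast
    have "v \<noteq> {#}" using u False by (auto simp: Units_closed)
    then obtain x y where xy: "v = add_mset x y" by (meson multiset_cases)
    have x: "x \<in> atoms G" "x \<in> carrier G" "set_mset y \<subseteq> carrier G" using v vc xy by auto
    have "cls (x \<otimes> u) = cls x" using u x by (simp add: cls_mult_unit)
    then have "x \<otimes> u \<in> atoms G" using x u cls_mem_atoms_iff by (metis Units_closed m_closed)
    moreover have "mset_prod G (add_mset (x \<otimes> u) y) = a"
      using x u xy by (simp add: Units_closed m_ac)
    ultimately have "product_of_atoms G k a"
      unfolding product_of_atoms_iff using v z xy
      by (intro exI[of _ "add_mset (x \<otimes> u) y"]) auto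
    then show "k \<in> length_set G a" using False by (simp add: length_set_def)
  qed
qed

text \<open>The unit class is included: its length is \<open>0\<close>, which gives the empty
  factorization.\<close>

lemma atomic_R:
  assumes "atomic G" "x \<in> carrier R"
  obtains z where "set_mset z \<subseteq> atoms R" "mset_prod R z = x"
proof -
  obtain a where a: "a \<in> carrier G" "x = cls a" using assms(2) by (auto simp: carrier_R)
  have "length_set G a \<noteq> {}"
    using assms(1) a by (auto simp: length_set_def atomic_def)
  then obtain z where "z \<in> factorizations G a" using a by (auto simp: length_set_eq)
  then show ?thesis using that a by (auto simp: factorizations_iff)
qed

text \<open>Divisibility of classes is divisibility of representatives, so the subproduct is chosen
  among lifts of the members of \<open>w\<close> and mapped back.\<close>

lemma omega_at_R:
  assumes p: "p \<in> carrier G" "omega_at G p \<le> enat N"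
    and w: "set_mset w \<subseteq> carrier R" "cls p divides\<^bsub>R\<^esub> mset_prod R w"
  obtains s where "s \<subseteq># w" "size s \<le> N" "cls p divides\<^bsub>R\<^esub> mset_prod R s"
proof -
  obtain v where v: "set_mset v \<subseteq> carrier G" "image_mset cls v = w"
    using obtain_lift_mset[of w "carrier G"] w(1) by (auto simp: carrier_R)
  then have "p divides mset_prod G v"
    using w(2) p by (auto simp: mset_prod_R divides_R_iff)
  then obtain t where t: "t \<subseteq># v" "size t \<le> N" "p divides mset_prod G t"
    using omega_at_mset[OF p(2) v(1)] by blast
  have "set_mset t \<subseteq> carrier G" using t(1) v(1) set_mset_mono by blast
  then have "cls p divides\<^bsub>R\<^esub> mset_prod R (image_mset cls t)"
    using t p by (simp add: mset_prod_R divides_R_iff)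
  then show ?thesis using that[of "image_mset cls t"] t v(2) image_mset_subseteq_mono by auto
qed

end

lemma (in comm_monoid_cancel) comm_monoid_cancel_R: "comm_monoid_cancel R"
proof -
  interpret R: comm_monoid R by (rule comm_monoid_R)
  show ?thesis
  proof (rule comm_monoid_cancelI)
    fix x y z assume "x \<in> carrier R" "y \<in> carrier R" "z \<in> carrier R" "x \<otimes>\<^bsub>R\<^esub> z = y \<otimes>\<^bsub>R\<^esub> z"
    then obtain a b c where abc: "a \<in> carrier G" "b \<in> carrier G" "c \<in> carrier G"
      "x = cls a" "y = cls b" "cls (a \<otimes> c) = cls (b \<otimes> c)"
      by (auto simp: carrier_R mult_R)
    then obtain u where u: "u \<in> Units G" "b \<otimes> c = a \<otimes> c \<otimes> u"
      using cls_eq_iff[of "a \<otimes> c" "b \<otimes> c"] by auto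
    then have "b \<otimes> c = a \<otimes> u \<otimes> c" using abc by (simp add: Units_closed m_ac)
    then have "b = a \<otimes> u" using abc u Units_closed r_cancel[of b c "a \<otimes> u"] by simp
    then show "x = y" using abc u by (simp add: cls_mult_unit)
  qed (rule comm_monoid_R)
qed

section \<open>Factorizations in cancellative monoids\<close>

lemma fdist_add_mset [simp]: "fdist (add_mset x y) (add_mset x z) = fdist y z"
  by (simp add: fdist_def)

text \<open>\<open>z - s\<close> is contained in both factorizations, hence in their gcd; the parts
  left over are no longer than \<open>s\<close> and \<open>t\<close>.\<close>

lemma fdist_le:
  assumes "s \<subseteq># z"
  shows "fdist z ((z - s) + t) \<le> max (size s) (size t)"
proof -
  define r where "r = z - s"
  have z: "z = r + s" using assms by (simp add: r_def)
  define x where "x = (r + s) \<inter># (r + t)"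
  have x: "r \<subseteq># x" "x \<subseteq># r + s" "x \<subseteq># r + t" by (simp_all add: x_def)
  have "size r \<le> size x" "size (r + s - x) + size x = size (r + s)"
    "size (r + t - x) + size x = size (r + t)"
    using size_mset_mono[OF x(1)] size_mset_mono[OF x(2)] size_mset_mono[OF x(3)]
      size_Diff_submset[OF x(2)] size_Diff_submset[OF x(3)] by linarith+
  then show ?thesis unfolding z by (simp add: fdist_def Let_def flip: x_def) linarith
qed

text \<open>Both lengths shrink by that of the gcd, and the rests have length at most
  \<open>fdist z y\<close>.\<close>

lemma size_le_fdist:
  "size y \<le> size z + fdist z y" "size z \<le> size y + fdist z y"
proof -
  define x where "x = z \<inter># y"
  have x: "x \<subseteq># z" "x \<subseteq># y" by (simp_all add: x_def)
  have "size (z - x) + size x = size z" "size (y - x) + size x = size y"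
    using size_mset_mono[OF x(1)] size_mset_mono[OF x(2)]
      size_Diff_submset[OF x(1)] size_Diff_submset[OF x(2)] by linarith+
  then show "size y \<le> size z + fdist z y" "size z \<le> size y + fdist z y"
    by (simp_all add: fdist_def Let_def flip: x_def)
qed

text \<open>One link of a chain as in the catenary degree. Only the target has to consist of atoms,
  which along a chain covers all members but the first.\<close>

definition bounded_step :: "('a, 'b) monoid_scheme \<Rightarrow> enat \<Rightarrow> 'a multiset \<Rightarrow> 'a multiset \<Rightarrow> bool" where
  "bounded_step G T y z \<longleftrightarrow>
     set_mset z \<subseteq> atoms G \<and> mset_prod G y = mset_prod G z \<and> enat (fdist y z) \<le> T"

text \<open>To be applied to the reduced monoid with \<open>N\<close> the value of
  \<open>omega\<close>. \<open>w\<close> ranges over arbitrary elements because a cofactor that need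
  not be an atom will be put among the factors.\<close>

locale cancellative_omega_bounded = comm_monoid_cancel G for G (structure) +
  fixes N :: nat
  assumes omega_bound: "\<lbrakk>p \<in> atoms G; set_mset w \<subseteq> carrier G; p divides mset_prod G w\<rbrakk> \<Longrightarrow>
      \<exists>s. s \<subseteq># w \<and> size s \<le> N \<and> p divides mset_prod G s"
begin

text \<open>
  Cancel the atoms of \<open>v\<close> one by one: each of them divides \<open>c\<close> times at most \<open>N\<close> members of
  \<open>w\<close>, and the cofactor becomes the new \<open>c\<close>.
\<close>

lemma size_le_size_mult:
  assumes "set_mset v \<subseteq> atoms G" "set_mset w \<subseteq> carrier G - Units G" "c \<in> carrier G"
    and "mset_prod G v = c \<otimes> mset_prod G w"
  shows "size w \<le> size v * N"
  using assms
proof (induction v arbitrary: w c)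
  case empty
  have "w = {#}"
  proof (rule ccontr)
    assume "w \<noteq> {#}"
    then obtain x y where xy: "w = add_mset x y" by (meson multiset_cases)
    with empty have x: "x \<in> carrier G" "x \<notin> Units G" "set_mset y \<subseteq> carrier G" by auto
    have "x \<otimes> (c \<otimes> mset_prod G y) = \<one>"
      using empty x xy by (simp add: m_lcomm)
    then have "x \<in> Units G" using x empty unit_factor[of x "c \<otimes> mset_prod G y"] by simp
    with x show False by simp
  qed
  then show ?case by simp
next
  case (add p v)
  have p: "p \<in> atoms G" "p \<in> carrier G" "set_mset v \<subseteq> atoms G" "set_mset v \<subseteq> carrier G"
    and w: "set_mset w \<subseteq> carrier G"
    using add.prems atoms_closed by auto
  have eq: "p \<otimes> mset_prod G v = c \<otimes> mset_prod G w" using add.prems p by simp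
  then have "p divides mset_prod G (add_mset c w)"
    using p w add.prems(3) eq[symmetric] by (auto simp: factor_def)
  then obtain s where s: "s \<subseteq># add_mset c w" "size s \<le> N" "p divides mset_prod G s"
    using omega_bound[OF p(1), of "add_mset c w"] w add.prems by auto
  define t where "t = s - {#c#}"
  have t: "t \<subseteq># w" "size t \<le> N"
    using s size_Diff_submset[of "{#c#}" s]
    by (auto simp: t_def subset_eq_diff_conv intro: order_trans[OF size_mset_mono[OF diff_subset_eq_self]])
  have sc: "set_mset s \<subseteq> carrier G" and tc: "set_mset t \<subseteq> carrier G"
    using set_mset_mono[OF s(1)] set_mset_mono[OF t(1)] w add.prems(3) by auto
  \<comment> \<open>\<open>s\<close> may or may not use the cofactor \<open>c\<close>; in both cases
    only \<open>t\<close>, at most \<open>N\<close> members of \<open>w\<close>, is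
    consumed.\<close>
  have "mset_prod G s divides c \<otimes> mset_prod G t"
  proof (cases "c \<in># s")
    case True
    then have "s = add_mset c t" by (simp add: t_def)
    then show ?thesis using tc add.prems by simp
  next
    case False
    then have "s = t" by (simp add: t_def)
    then show ?thesis using tc add.prems by (auto simp: factor_def m_comm)
  qed
  then have "p divides c \<otimes> mset_prod G t"
    using s(3) p tc sc add.prems by (meson divides_trans)
  then obtain b where b: "b \<in> carrier G" "c \<otimes> mset_prod G t = p \<otimes> b"
    by (auto simp: factor_def)
  have wt: "set_mset (w - t) \<subseteq> carrier G - Units G" "set_mset (w - t) \<subseteq> carrier G"
    using add.prems by (auto dest: in_diffD)
  have "p \<otimes> mset_prod G v = c \<otimes> (mset_prod G t \<otimes> mset_prod G (w - t))"
    using eq mset_prod_diff[OF t(1) w] by simp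
  also have "\<dots> = p \<otimes> (b \<otimes> mset_prod G (w - t))"
    using b add.prems p tc wt by (simp flip: m_assoc)
  finally have "mset_prod G v = b \<otimes> mset_prod G (w - t)"
    using p b wt by (metis l_cancel m_closed mset_prod_closed)
  then have "size (w - t) \<le> size v * N" using add.IH p wt b by blast
  then show ?case using t size_Diff_submset[OF t(1)] by simp
qed

lemma size_le_size_mult':
  assumes "set_mset v \<subseteq> atoms G" "set_mset w \<subseteq> atoms G" "mset_prod G v = mset_prod G w"
  shows "size w \<le> size v * N"
proof (rule size_le_size_mult[where c = \<one>])
  have "set_mset w \<subseteq> carrier G" using assms atoms_closed by auto
  then show "mset_prod G v = \<one> \<otimes> mset_prod G w" using assms by simp
qed (use assms in \<open>auto simp: atoms_def\<close>)

text \<open>Common start of \<open>tame_bound\<close> and \<open>remove_atom_bound\<close>: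
  \<open>p\<close> is extracted from at most \<open>N\<close> atoms of \<open>z\<close>, and the
  others stay.\<close>

lemma exchange_atom:
  assumes "p \<in> atoms G" "set_mset z \<subseteq> atoms G" "p divides mset_prod G z"
  obtains s b where "s \<subseteq># z" "size s \<le> N" "b \<in> carrier G" "mset_prod G s = p \<otimes> b"
    "mset_prod G z = p \<otimes> (b \<otimes> mset_prod G (z - s))"
proof -
  have zc: "set_mset z \<subseteq> carrier G" using assms atoms_closed by auto
  obtain s where s: "s \<subseteq># z" "size s \<le> N" "p divides mset_prod G s"
    using omega_bound[OF assms(1) zc assms(3)] by blast
  then obtain b where b: "b \<in> carrier G" "mset_prod G s = p \<otimes> b" by (auto simp: factor_def)
  have "set_mset (z - s) \<subseteq> carrier G" using zc by (auto dest: in_diffD)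
  then have "mset_prod G z = p \<otimes> (b \<otimes> mset_prod G (z - s))"
    using mset_prod_diff[OF s(1) zc] b atoms_closed[OF assms(1)] by (simp add: m_assoc)
  with that s b show ?thesis by blast
qed

text \<open>Only \<open>s\<close> is replaced, namely by \<open>p\<close> and a factorization of
  \<open>b\<close>. By \<open>size_le_size_mult'\<close> this new part has at most
  \<open>size s * N\<close> atoms.\<close>

lemma tame_bound:
  assumes "p \<in> atoms G" "set_mset z \<subseteq> atoms G" "p divides mset_prod G z"
    and factor: "\<And>x. x \<in> carrier G \<Longrightarrow> \<exists>z. set_mset z \<subseteq> atoms G \<and> mset_prod G z = x"
  obtains y where "set_mset y \<subseteq> atoms G" "mset_prod G (add_mset p y) = mset_prod G z"
    "fdist z (add_mset p y) \<le> N * N"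
proof -
  obtain s b where s: "s \<subseteq># z" "size s \<le> N" "b \<in> carrier G" "mset_prod G s = p \<otimes> b"
    "mset_prod G z = p \<otimes> (b \<otimes> mset_prod G (z - s))"
    using exchange_atom[OF assms(1-3)] .
  obtain w where w: "set_mset w \<subseteq> atoms G" "mset_prod G w = b" using factor s(3) by blast
  have pc: "p \<in> carrier G" and wc: "set_mset w \<subseteq> carrier G"
    and zs: "set_mset (z - s) \<subseteq> atoms G" "set_mset (z - s) \<subseteq> carrier G"
    and sa: "set_mset s \<subseteq> atoms G"
    using assms(1,2) w(1) atoms_closed set_mset_mono[OF s(1)] by (auto dest: in_diffD)
  define y where "y = (z - s) + w"
  have "size (add_mset p w) \<le> size s * N"
    using assms(1) w pc wc sa s by (intro size_le_size_mult') auto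
  also have "\<dots> \<le> N * N" using s(2) by simp
  finally have *: "size (add_mset p w) \<le> N * N" .
  then have "1 \<le> N" by (cases N) auto
  then have "size s \<le> N * N" using s(2) by (meson le_square le_trans)
  then have "fdist z ((z - s) + add_mset p w) \<le> N * N"
    using fdist_le[OF s(1), of "add_mset p w"] * by linarith
  then have "fdist z (add_mset p y) \<le> N * N" by (simp add: y_def)
  moreover have "mset_prod G y = b \<otimes> mset_prod G (z - s)"
    using w zs wc s(3) unfolding y_def by (subst mset_prod_union) (auto simp: m_comm)
  then have "mset_prod G (add_mset p y) = mset_prod G z"
    using s(5) pc zs wc by (simp add: y_def)
  moreover have "set_mset y \<subseteq> atoms G" using zs w by (auto simp: y_def)
  ultimately show ?thesis using that by blast
qed

text \<open>In \<open>z\<close> the part \<open>s\<close> is traded for \<open>p\<close> and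
  \<open>w\<close>, and \<open>p\<close> is cancelled. If \<open>w\<close> is nonempty, the loss is
  at most \<open>N - 1\<close>; if it is empty, \<open>s\<close> has product \<open>p\<close> and so
  at most one atom, whence the \<open>1\<close> in the maximum.\<close>

lemma remove_atom_bound:
  assumes "p \<in> atoms G" "set_mset v \<subseteq> atoms G" "v \<noteq> {#}" "set_mset z \<subseteq> atoms G"
    and "mset_prod G z = mset_prod G (add_mset p v)" and Units: "Units G = {\<one>}"
    and factor: "\<And>x. x \<in> carrier G \<Longrightarrow> \<exists>z. set_mset z \<subseteq> atoms G \<and> mset_prod G z = x"
  obtains w where "set_mset w \<subseteq> atoms G" "mset_prod G w = mset_prod G v"
    "size z \<le> size w + max 1 (N - 1)"
proof -
  have pc: "p \<in> carrier G" and vc: "set_mset v \<subseteq> carrier G" and zc: "set_mset z \<subseteq> carrier G"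
    using assms atoms_closed by auto
  have "p divides mset_prod G z" using assms(5) pc vc by (auto simp: factor_def)
  then obtain s b where s: "s \<subseteq># z" "size s \<le> N" "b \<in> carrier G" "mset_prod G s = p \<otimes> b"
    "mset_prod G z = p \<otimes> (b \<otimes> mset_prod G (z - s))"
    using exchange_atom[OF assms(1,4)] by blast
  have zs: "set_mset (z - s) \<subseteq> atoms G" "set_mset (z - s) \<subseteq> carrier G"
    using assms(4) zc by (auto dest: in_diffD)
  have v: "mset_prod G v = b \<otimes> mset_prod G (z - s)"
    using s assms(5) pc vc zs by (metis l_cancel m_closed mset_prod_add_mset mset_prod_closed)
  obtain w where w: "set_mset w \<subseteq> atoms G" "mset_prod G w = b" using factor s(3) by blast
  have wc: "set_mset w \<subseteq> carrier G" using w atoms_closed by auto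
  have "size s \<le> size w + max 1 (N - 1)"
  proof (cases "w = {#}")
    case True
    then have ps: "mset_prod G s = p" using s w pc by auto
    have sa: "set_mset s \<subseteq> atoms G" "set_mset s \<subseteq> carrier G"
      using set_mset_mono[OF s(1)] assms(4) zc by auto
    have "size s \<le> 1"
    proof (cases s)
      case (add x t)
      have x: "x \<in> atoms G" "x \<in> carrier G" "set_mset t \<subseteq> atoms G" "set_mset t \<subseteq> carrier G"
        using sa add by auto
      then have "p = x \<otimes> mset_prod G t" using ps add by simp
      moreover have "mset_prod G t \<in> carrier G" "x \<notin> Units G" using x by (simp_all add: atoms_def)
      ultimately have "mset_prod G t \<in> Units G" using assms(1) x(2) unfolding atoms_def by blast
      then have "mset_prod G t = \<one>" using Units by simp
      \<comment> \<open>\<open>size_le_size_mult\<close> with the empty multiset on the left shows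
        that a product of atoms equal to \<open>\<one>\<close> is empty.\<close>
      then have "mset_prod G {#} = \<one> \<otimes> mset_prod G t" by simp
      moreover have "set_mset t \<subseteq> carrier G - Units G" using x by (auto simp: atoms_def)
      ultimately have "size t \<le> size ({#} :: 'a multiset) * N"
        by (intro size_le_size_mult[where c = \<one>]) auto
      then show ?thesis using add by simp
    qed simp
    then show ?thesis by simp
  next
    case False
    then have "size w \<ge> 1" by (simp add: Suc_le_eq nonempty_has_size)
    then show ?thesis using s(2) by simp
  qed
  then have "size z \<le> size (w + (z - s)) + max 1 (N - 1)"
    using size_Diff_submset[OF s(1)] size_mset_mono[OF s(1)] by simp
  moreover have "mset_prod G (w + (z - s)) = mset_prod G v"
    using v w wc zs by (simp add: mset_prod_union)
  ultimately show ?thesis using that[of "w + (z - s)"] w zs by auto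
qed

end

text \<open>
  Replace \<open>z\<close> by a factorization sharing an atom \<open>p\<close> with \<open>z'\<close> and cancel \<open>p\<close>.
\<close>

lemma (in comm_monoid_cancel) chain_of_tame_steps:
  assumes tame: "\<And>p z. \<lbrakk>p \<in> atoms G; set_mset z \<subseteq> atoms G; p divides mset_prod G z\<rbrakk> \<Longrightarrow>
      \<exists>y. set_mset y \<subseteq> atoms G \<and> mset_prod G (add_mset p y) = mset_prod G z \<and>
        enat (fdist z (add_mset p y)) \<le> T"
    and "set_mset z \<subseteq> atoms G" "set_mset z' \<subseteq> atoms G" "mset_prod G z = mset_prod G z'"
  shows "(bounded_step G T)\<^sup>*\<^sup>* z z'"
  using assms(2-)
proof (induction z' arbitrary: z)
  case empty
  have "z = {#}"
  proof (cases z)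
    case (add x t)
    then have x: "x \<in> atoms G" "x \<in> carrier G" "set_mset t \<subseteq> carrier G"
      using empty atoms_closed by auto
    then have "x \<otimes> mset_prod G t = \<one>" using empty add by simp
    then have "x \<in> Units G" using x unit_factor[of x "mset_prod G t"] by simp
    with x show ?thesis by (simp add: atoms_def)
  qed
  then show ?case by simp
next
  case (add p z')
  have p: "p \<in> atoms G" "p \<in> carrier G" "set_mset z' \<subseteq> atoms G" "set_mset z' \<subseteq> carrier G"
    using add.prems atoms_closed by auto
  have "p divides mset_prod G z" using add.prems(3) p by (auto simp: factor_def)
  then obtain y where y: "set_mset y \<subseteq> atoms G" "mset_prod G (add_mset p y) = mset_prod G z"
      "enat (fdist z (add_mset p y)) \<le> T"
    using tame[OF p(1) add.prems(1)] by blast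
  have yc: "set_mset y \<subseteq> carrier G" using y atoms_closed by auto
  have "p \<otimes> mset_prod G y = p \<otimes> mset_prod G z'"
    using y(2) add.prems(3) p yc by simp
  then have "mset_prod G y = mset_prod G z'" using p yc by (metis l_cancel mset_prod_closed)
  then have "(bounded_step G T)\<^sup>*\<^sup>* y z'" using add.IH y p by blast
  \<comment> \<open>Putting \<open>p\<close> into every member of the chain does not change the
    distances. The conjunct on atoms is carried along because a step speaks of its target
    only.\<close>
  then have "(bounded_step G T)\<^sup>*\<^sup>* (add_mset p y) (add_mset p z') \<and> set_mset z' \<subseteq> atoms G"
  proof (induction rule: rtranclp_induct)
    case (step u v)
    then have "set_mset u \<subseteq> carrier G" "set_mset v \<subseteq> carrier G"
      using atoms_closed by (auto simp: bounded_step_def)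
    then have "bounded_step G T (add_mset p u) (add_mset p v)"
      using step.hyps(2) p by (simp add: bounded_step_def)
    moreover have "set_mset v \<subseteq> atoms G" using step.hyps(2) by (simp add: bounded_step_def)
    ultimately show ?case using step.IH by (meson rtranclp.rtrancl_into_rtrancl)
  qed (use y in simp)
  then have "(bounded_step G T)\<^sup>*\<^sup>* (add_mset p y) (add_mset p z')" ..
  moreover have "bounded_step G T z (add_mset p y)" using y p by (auto simp: bounded_step_def)
  ultimately show ?case by (meson converse_rtranclp_into_rtranclp)
qed

section \<open>Arithmetic of atomic monoids\<close>

context comm_monoid
begin

section \<open>Catenary degree and distances\<close>

lemma catenary_chain:
  assumes "z \<in> factorizations G a" "z' \<in> factorizations G a"
  obtains k c where "c 0 = z" "c k = z'" "\<And>i. i \<le> k \<Longrightarrow> c i \<in> factorizations G a"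
    "\<And>i. i \<in> {1..k::nat} \<Longrightarrow> enat (fdist (c (i - 1)) (c i)) \<le> catenary_degree_at G a"
proof -
  define P where "P N \<longleftrightarrow> (\<forall>z\<in>factorizations G a. \<forall>z'\<in>factorizations G a.
        \<exists>(k::nat) c. c 0 = z \<and> c k = z' \<and> (\<forall>i\<le>k. c i \<in> factorizations G a) \<and>
          (\<forall>i\<in>{1..k}. enat (fdist (c (i - 1)) (c i)) \<le> N))" for N
  \<comment> \<open>Without a bound the two-member chain from \<open>z\<close> to \<open>z'\<close>
    will do; so the least admissible value exists and is admissible.\<close>
  have "P \<infinity>"
    unfolding P_def
  proof (intro ballI)
    fix z z' assume "z \<in> factorizations G a" "z' \<in> factorizations G a"
    then show "\<exists>(k::nat) c. c 0 = z \<and> c k = z' \<and> (\<forall>i\<le>k. c i \<in> factorizations G a) \<and>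
          (\<forall>i\<in>{1..k}. enat (fdist (c (i - 1)) (c i)) \<le> \<infinity>)"
      by (intro exI[of _ 1] exI[of _ "\<lambda>i. if i = 0 then z else z'"]) auto
  qed
  then have "P (catenary_degree_at G a)"
    unfolding catenary_degree_at_def P_def[symmetric] by (rule LeastI)
  then show ?thesis using assms that unfolding P_def by metis
qed

lemma distances_le_catenary_degree:
  assumes "d \<in> distances G"
  shows "enat d \<le> catenary_degree G"
proof -
  obtain a where a: "a \<in> carrier G" "d \<in> delta_set (length_set G a)"
    using assms by (auto simp: distances_def length_system_def)
  then obtain l where l: "d \<ge> 1" "l \<in> length_set G a" "l + d \<in> length_set G a"
    "length_set G a \<inter> {l..l + d} = {l, l + d}"
    by (auto simp: delta_set_def)
  then obtain z z' where z: "z \<in> factorizations G a" "size z = l"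
      "z' \<in> factorizations G a" "size z' = l + d"
    using a by (auto simp: length_set_eq)
  obtain k c where c: "c 0 = z" "c k = z'" "\<And>i. i \<le> k \<Longrightarrow> c i \<in> factorizations G a"
    "\<And>i. i \<in> {1..k::nat} \<Longrightarrow> enat (fdist (c (i - 1)) (c i)) \<le> catenary_degree_at G a"
    using catenary_chain[OF z(1,3)] by metis
  \<comment> \<open>\<open>i\<close> is the first place where the chain reaches length
    \<open>l + d\<close>. The member before it is shorter, hence of length at most \<open>l\<close>,
    as no length lies strictly between.\<close>
  define i where "i = (LEAST i. l + d \<le> size (c i))"
  have i: "l + d \<le> size (c i)" "i \<le> k"
    using LeastI[of "\<lambda>i. l + d \<le> size (c i)" k] Least_le[of "\<lambda>i. l + d \<le> size (c i)" k] c z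
    by (simp_all add: i_def)
  have "i \<noteq> 0" using i(1) c(1) z(2) l(1) by (cases i) auto
  then have less: "size (c (i - 1)) < l + d"
    using not_less_Least[of "i - 1" "\<lambda>i. l + d \<le> size (c i)"] by (simp add: i_def not_le)
  have "size (c (i - 1)) \<in> length_set G a"
    using c(3)[of "i - 1"] i(2) a by (auto simp: length_set_eq)
  then have "size (c (i - 1)) \<le> l"
    using l(4) less by (cases "l \<le> size (c (i - 1))") auto
  then have "d \<le> fdist (c (i - 1)) (c i)"
    using i(1) size_le_fdist(1)[of "c i" "c (i - 1)"] by linarith
  then have "enat d \<le> enat (fdist (c (i - 1)) (c i))" by simp
  also have "\<dots> \<le> catenary_degree_at G a" using c(4)[of i] i(2) \<open>i \<noteq> 0\<close> by simp
  finally have "enat d \<le> catenary_degree_at G a" .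
  also have "\<dots> \<le> catenary_degree G" using a by (simp add: catenary_degree_def SUP_upper)
  finally show ?thesis .
qed

lemma finite_distances: "catenary_degree G < \<infinity> \<Longrightarrow> finite (distances G)"
  using distances_le_catenary_degree
  by (cases "catenary_degree G") (auto intro: finite_subset[of _ "{.._}"])

section \<open>Sets of lengths, their unions, and elasticity\<close>

lemma factorizations_mult:
  assumes "a \<in> carrier G" "b \<in> carrier G" "y \<in> factorizations G a" "z \<in> factorizations G b"
  shows "y + z \<in> factorizations G (a \<otimes> b)"
proof -
  interpret R: comm_monoid R by (rule comm_monoid_R)
  have "set_mset y \<subseteq> carrier R" "set_mset z \<subseteq> carrier R"
    using assms R.atoms_closed by (auto simp: factorizations_iff)
  then show ?thesis
    using assms by (auto simp: factorizations_iff R.mset_prod_union mult_R)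
qed

lemma length_set_atom:
  assumes "p \<in> atoms G"
  shows "1 \<in> length_set G p"
proof -
  interpret R: comm_monoid R by (rule comm_monoid_R)
  have p: "p \<in> carrier G" "cls p \<in> atoms R" "cls p \<in> carrier R"
    using assms atoms_closed cls_mem_atoms_iff R.atoms_closed by blast+
  then have "{#cls p#} \<in> factorizations G p" by (simp add: factorizations_iff)
  then show ?thesis using p by (force simp: length_set_eq)
qed

lemma ex_atom:
  assumes "atomic G" "carrier G \<noteq> Units G"
  obtains p where "p \<in> atoms G"
proof -
  obtain a where a: "a \<in> carrier G" "a \<notin> Units G" using assms(2) Units_closed by blast
  then obtain k where "product_of_atoms G k a" using assms(1) by (auto simp: atomic_def)
  then obtain z where z: "set_mset z \<subseteq> atoms G" "mset_prod G z = a"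
    by (auto simp: product_of_atoms_iff)
  then have "z \<noteq> {#}" using a by auto
  then show ?thesis using z(1) that by (meson multiset_nonemptyE subsetD)
qed

lemma subadditive_family_length_system:
  assumes "atomic G" "carrier G \<noteq> Units G"
  shows "subadditive_family (length_system G)"
proof
  fix L L' assume "L \<in> length_system G" "L' \<in> length_system G"
  then obtain a b where ab: "a \<in> carrier G" "b \<in> carrier G" "L = length_set G a" "L' = length_set G b"
    by (auto simp: length_system_def)
  have "x + y \<in> length_set G (a \<otimes> b)" if xy: "x \<in> L" "y \<in> L'" for x y
  proof -
    obtain z z' where z: "z \<in> factorizations G a" "z' \<in> factorizations G b" "x = size z" "y = size z'"
      using xy ab by (auto simp: length_set_eq)
    then have "z + z' \<in> factorizations G (a \<otimes> b)" using factorizations_mult[OF ab(1,2)] by blast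
    then show ?thesis using z ab by (auto simp: length_set_eq simp flip: size_union)
  qed
  then show "\<exists>L''\<in>length_system G. \<forall>x\<in>L. \<forall>y\<in>L'. x + y \<in> L''"
    using ab by (auto simp: length_system_def)
next
  have "length_set G \<one> = {0}" by (simp add: length_set_def)
  then show "{0} \<in> length_system G" unfolding length_system_def by (metis image_eqI one_closed)
next
  fix L assume "L \<in> length_system G" "0 \<in> L"
  then obtain a where a: "a \<in> carrier G" "L = length_set G a" "0 \<in> length_set G a"
    by (auto simp: length_system_def)
  interpret R: comm_monoid R by (rule comm_monoid_R)
  have "cls a = \<one>\<^bsub>R\<^esub>" using a by (auto simp: length_set_eq factorizations_iff)
  then have "a \<in> Units G" using a by (simp add: cls_eq_one_iff)
  then show "L = {0}" using a by (simp add: length_set_def)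
next
  obtain p where "p \<in> atoms G" using ex_atom[OF assms] .
  then show "\<exists>L\<in>length_system G. 1 \<in> L"
    using length_set_atom atoms_closed by (auto simp: length_system_def)
qed

text \<open>The element of the monoid is eliminated in favour of two factorizations with equal
  product in \<open>R\<close>, to which the size bounds for cancellative monoids apply.\<close>

lemma mem_unions_iff:
  assumes "carrier G \<noteq> Units G"
  shows "l \<in> unions G k \<longleftrightarrow> (\<exists>z z'. set_mset z \<subseteq> atoms R \<and> set_mset z' \<subseteq> atoms R \<and>
    mset_prod R z = mset_prod R z' \<and> size z = k \<and> size z' = l)"
proof
  assume "l \<in> unions G k"
  then obtain a where "a \<in> carrier G" "k \<in> length_set G a" "l \<in> length_set G a"
    using assms by (auto simp: unions_def length_system_def)
  then obtain z z' where "z \<in> factorizations G a" "z' \<in> factorizations G a" "size z = k" "size z' = l"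
    by (auto simp: length_set_eq)
  then show "\<exists>z z'. set_mset z \<subseteq> atoms R \<and> set_mset z' \<subseteq> atoms R \<and>
    mset_prod R z = mset_prod R z' \<and> size z = k \<and> size z' = l"
    unfolding factorizations_iff by metis
next
  interpret R: comm_monoid R by (rule comm_monoid_R)
  assume "\<exists>z z'. set_mset z \<subseteq> atoms R \<and> set_mset z' \<subseteq> atoms R \<and>
    mset_prod R z = mset_prod R z' \<and> size z = k \<and> size z' = l"
  then obtain z z' where z: "set_mset z \<subseteq> atoms R" "set_mset z' \<subseteq> atoms R"
    "mset_prod R z = mset_prod R z'" "size z = k" "size z' = l" by blast
  then have "set_mset z \<subseteq> carrier R" using R.atoms_closed by blast
  then have "mset_prod R z \<in> carrier R" by (rule R.mset_prod_closed)
  then obtain a where a: "a \<in> carrier G" "cls a = mset_prod R z" by (auto simp: carrier_R)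
  then have "z \<in> factorizations G a" "z' \<in> factorizations G a" using z by (auto simp: factorizations_iff)
  then have "k \<in> length_set G a" "l \<in> length_set G a" using a z by (auto simp: length_set_eq)
  then show "l \<in> unions G k" using assms a by (auto simp: unions_def length_system_def)
qed

lemma rho_Suc_le:
  assumes "\<And>l. l \<in> unions G (k + 1) \<Longrightarrow> \<exists>l'\<in>unions G k. l \<le> l' + K"
  shows "rho G (k + 1) \<le> rho G k + enat K"
  unfolding rho_def
proof (rule SUP_least)
  fix l assume "l \<in> unions G (k + 1)"
  then obtain l' where l': "l' \<in> unions G k" "l \<le> l' + K" using assms by blast
  then have "enat l \<le> enat l' + enat K" by simp
  also have "\<dots> \<le> (SUP l\<in>unions G k. enat l) + enat K"
    using l' by (intro add_right_mono SUP_upper)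
  finally show "enat l \<le> (SUP l\<in>unions G k. enat l) + enat K" .
qed

lemma structure_theorem_for_unionsI:
  assumes "atomic G" "carrier G \<noteq> Units G" "finite (distances G)"
    and "\<And>k. k \<ge> 1 \<Longrightarrow> finite (unions G k)"
    and "\<And>k l. \<lbrakk>k \<ge> 1; l \<in> unions G (k + 1)\<rbrakk> \<Longrightarrow> \<exists>l'\<in>unions G k. l \<le> l' + K"
  shows "structure_theorem_for_unions G"
proof -
  interpret subadditive_family "length_system G"
    using assms(1,2) by (rule subadditive_family_length_system)
  have U: "U = unions G" using assms(2) by (auto simp: U_def unions_def fun_eq_iff)
  have "\<exists>d\<ge>1. \<exists>M. \<exists>k0. \<forall>k\<ge>k0. is_AAP d M (U k)"
    using assms(3-5) by (intro structure_theorem) (auto simp: U distances_def)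
  then show ?thesis by (simp add: structure_theorem_for_unions_def U)
qed

lemma structure_theorem_for_unions_group:
  "carrier G = Units G \<Longrightarrow> structure_theorem_for_unions G"
  unfolding structure_theorem_for_unions_def unions_def
  using is_AAP_singleton by (intro exI[of _ 1] exI[of _ 0]) auto

text \<open>\<open>K\<close> is the numerator of an attained ratio \<open>m / n\<close>. As no ratio
  exceeds the elasticity, \<open>l * n \<le> k * m\<close> for \<open>l\<close> in
  \<open>U k\<close>, which also makes the unions finite.\<close>

lemma accepted_elasticity_bounds:
  assumes "atomic G" "carrier G \<noteq> Units G" "accepted_elasticity G"
  obtains K where "\<And>k. k \<ge> 1 \<Longrightarrow> finite (unions G k)"
    "\<And>k l. \<lbrakk>k \<ge> 1; l \<in> unions G (k + 1)\<rbrakk> \<Longrightarrow> \<exists>l'\<in>unions G k. l \<le> l' + K"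
proof -
  interpret subadditive_family "length_system G"
    using assms(1,2) by (rule subadditive_family_length_system)
  have U: "U = unions G" using assms(2) by (auto simp: U_def unions_def fun_eq_iff)
  obtain L where L: "L \<in> length_system G" "elasticity G = elasticity_of_set L" "elasticity_of_set L < \<infinity>"
    using assms(3) by (auto simp: accepted_elasticity_def)
  obtain n m where nm: "n \<ge> 1" "elasticity G = of_nat m / of_nat n"
    "n \<in> L \<and> m \<in> L \<or> n = 1 \<and> m = 1"
    using elasticity_of_set_attained[OF L(3)] L(2) by metis
  \<comment> \<open>The default pair \<open>1\<close>, \<open>1\<close> is covered by
    reflexivity.\<close>
  have "m \<in> U n" using nm(3) L(1) U_refl by (auto simp: U_iff)
  have bound: "l * n \<le> k * m" if kl: "l \<in> U k" for k l
  proof (cases "k \<ge> 1")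
    case True
    obtain L' where L': "L' \<in> length_system G" "k \<in> L'" "l \<in> L'" using kl by (auto simp: U_iff)
    have "of_nat l / of_nat k \<le> elasticity_of_set L'"
      using L' True by (intro ratio_le_elasticity_of_set)
    also have "\<dots> \<le> of_nat m / of_nat n"
      using L' unfolding nm(2)[symmetric] elasticity_def by (intro SUP_upper)
    finally have "real l / real k \<le> real m / real n"
      using True nm(1) by (simp add: ennreal_of_nat_divide)
    then have "real (l * n) \<le> real (k * m)" using True nm(1) by (simp add: field_simps)
    then show ?thesis by (simp only: of_nat_le_iff)
  next
    case False
    then have "k = 0" by simp
    \<comment> \<open>Only \<open>{0}\<close> contains the length \<open>0\<close>, so
      \<open>l = 0\<close>.\<close>
    then show ?thesis using kl zero_unique by (fastforce simp: U_iff)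
  qed
  show ?thesis
  proof (rule that[of m])
    fix k
    have "l \<le> k * m" if "l \<in> U k" for l
    proof -
      have "l \<le> l * n" using nm(1) by simp
      then show ?thesis using bound[OF that] by linarith
    qed
    then show "finite (unions G k)" unfolding U[symmetric]
      by (intro finite_subset[of "U k" "{..k * m}"]) auto
    show "\<exists>l'\<in>unions G k. l \<le> l' + m" if "l \<in> unions G (k + 1)" for l
      using Sup_U_Suc_le[OF \<open>m \<in> U n\<close> nm(1) bound] that by (simp add: U)
  qed
qed

section \<open>Tame degree and catenary degree\<close>

lemma tame_degree_step:
  assumes "atomic G" "p \<in> atoms R" "set_mset z \<subseteq> atoms R" "p divides\<^bsub>R\<^esub> mset_prod R z"
  shows "\<exists>y. set_mset y \<subseteq> atoms R \<and> mset_prod R (add_mset p y) = mset_prod R z \<and>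
    enat (fdist z (add_mset p y)) \<le> tame_degree G"
proof -
  interpret R: comm_monoid R by (rule comm_monoid_R)
  define P where "P N \<longleftrightarrow> (\<forall>a\<in>carrier G.
        factorizations G a \<inter> add_mset p ` factorization_monoid G \<noteq> {} \<longrightarrow>
        (\<forall>z\<in>factorizations G a.
           \<exists>z'\<in>factorizations G a \<inter> add_mset p ` factorization_monoid G.
             enat (fdist z z') \<le> N))" for N
  have "P \<infinity>" unfolding P_def by auto
  then have P: "P (tame_degree_at G p)"
    unfolding tame_degree_at_def P_def[symmetric] by (rule LeastI)
  have "mset_prod R z \<in> carrier R" using assms(3) R.atoms_closed by auto
  then obtain a where a: "a \<in> carrier G" "cls a = mset_prod R z" by (auto simp: carrier_R)
  obtain b where b: "b \<in> carrier R" "mset_prod R z = p \<otimes>\<^bsub>R\<^esub> b"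
    using assms(4) by (auto simp: factor_def)
  \<comment> \<open>Atomicity turns divisibility by \<open>p\<close> into a factorization of
    \<open>a\<close> containing \<open>p\<close>, as the definition of the tame degree
    demands.\<close>
  obtain w where w: "set_mset w \<subseteq> atoms R" "mset_prod R w = b" using atomic_R[OF assms(1) b(1)] .
  have "p \<in> carrier R" "set_mset w \<subseteq> carrier R" using assms(2) w(1) R.atoms_closed by auto
  then have "add_mset p w \<in> factorizations G a \<inter> add_mset p ` factorization_monoid G"
    using a b w assms(2) by (auto simp: factorizations_iff factorization_monoid_def)
  moreover have "z \<in> factorizations G a" using assms(3) a by (simp add: factorizations_iff)
  ultimately obtain z' where z': "z' \<in> factorizations G a" "z' \<in> add_mset p ` factorization_monoid G"
    "enat (fdist z z') \<le> tame_degree_at G p"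
    using P a(1) unfolding P_def by blast
  then obtain y where y: "z' = add_mset p y" "set_mset y \<subseteq> atoms R"
    by (auto simp: factorization_monoid_def)
  have "tame_degree_at G p \<le> tame_degree G"
    using assms(2) by (simp add: tame_degree_def SUP_upper)
  then have "enat (fdist z (add_mset p y)) \<le> tame_degree G" using z'(3) y(1) by (metis order_trans)
  moreover have "mset_prod R (add_mset p y) = mset_prod R z"
    using z'(1) y(1) a(2) by (simp add: factorizations_iff)
  ultimately show ?thesis using y(2) by blast
qed

lemma tame_degree_le:
  assumes "\<And>p z. \<lbrakk>p \<in> atoms R; set_mset z \<subseteq> atoms R; p divides\<^bsub>R\<^esub> mset_prod R z\<rbrakk> \<Longrightarrow>
    \<exists>y. set_mset y \<subseteq> atoms R \<and> mset_prod R (add_mset p y) = mset_prod R z \<and>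
      enat (fdist z (add_mset p y)) \<le> T"
  shows "tame_degree G \<le> T"
  unfolding tame_degree_def
proof (rule SUP_least)
  interpret R: comm_monoid R by (rule comm_monoid_R)
  fix p assume p: "p \<in> atoms R"
  show "tame_degree_at G p \<le> T"
    unfolding tame_degree_at_def
  proof (rule Least_le, intro ballI impI)
    fix a z assume a: "a \<in> carrier G" and z: "z \<in> factorizations G a"
      and ne: "factorizations G a \<inter> add_mset p ` factorization_monoid G \<noteq> {}"
    then obtain w where w: "add_mset p w \<in> factorizations G a" by blast
    then have wc: "set_mset w \<subseteq> carrier R" and pc: "p \<in> carrier R"
      using p R.atoms_closed by (auto simp: factorizations_iff)
    have "mset_prod R z = mset_prod R (add_mset p w)" using w z by (simp add: factorizations_iff)
    then have "p divides\<^bsub>R\<^esub> mset_prod R z" using wc pc by (auto simp: factor_def)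
    then obtain y where "set_mset y \<subseteq> atoms R" "mset_prod R (add_mset p y) = mset_prod R z"
      "enat (fdist z (add_mset p y)) \<le> T"
      using assms[OF p, of z] z unfolding factorizations_iff by blast
    then show "\<exists>z'\<in>factorizations G a \<inter> add_mset p ` factorization_monoid G. enat (fdist z z') \<le> T"
      using z p by (intro bexI[of _ "add_mset p y"]) (auto simp: factorizations_iff factorization_monoid_def)
  qed
qed

lemma catenary_degree_le:
  assumes "\<And>z z'. \<lbrakk>set_mset z \<subseteq> atoms R; set_mset z' \<subseteq> atoms R; mset_prod R z = mset_prod R z'\<rbrakk> \<Longrightarrow>
    (bounded_step R T)\<^sup>*\<^sup>* z z'"
  shows "catenary_degree G \<le> T"
  unfolding catenary_degree_def
proof (rule SUP_least)
  fix a
  show "catenary_degree_at G a \<le> T"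
    unfolding catenary_degree_at_def
  proof (rule Least_le, intro ballI)
    fix z z' assume z: "z \<in> factorizations G a" "z' \<in> factorizations G a"
    then have "(bounded_step R T)\<^sup>*\<^sup>* z z'"
      using assms[of z z'] by (simp add: factorizations_iff)
    \<comment> \<open>A path of \<open>k\<close> steps is an indexed chain; equality of products
      propagates along it, so every member is a factorization of \<open>a\<close>.\<close>
    then obtain k where "(bounded_step R T ^^ k) z z'" by (auto simp: rtranclp_power)
    then obtain c where c: "c 0 = z" "c k = z'"
        "\<And>i. i < k \<Longrightarrow> bounded_step R T (c i) (c (Suc i))"
      by (auto simp: relpowp_fun_conv)
    have "c i \<in> factorizations G a" if "i \<le> k" for i
      using that
    proof (induction i)
      case (Suc i)
      then show ?case using c(3)[of i] by (simp add: factorizations_iff bounded_step_def)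
    qed (use c z in auto)
    moreover have "enat (fdist (c (i - 1)) (c i)) \<le> T" if "i \<in> {1..k}" for i
      using c(3)[of "i - 1"] that by (cases i) (auto simp: bounded_step_def)
    ultimately show "\<exists>(k::nat) c. c 0 = z \<and> c k = z' \<and> (\<forall>i\<le>k. c i \<in> factorizations G a) \<and>
          (\<forall>i\<in>{1..k}. enat (fdist (c (i - 1)) (c i)) \<le> T)"
      using c by blast
  qed
qed

end

text \<open>Every atom of the reduced monoid is the class of an atom of \<open>G\<close>, whose
  \<open>omega_at\<close> value is at most the supremum \<open>N\<close>.\<close>

lemma (in comm_monoid_cancel) cancellative_omega_bounded_R:
  assumes "omega G = enat N"
  shows "cancellative_omega_bounded R N"
proof -
  interpret R: comm_monoid_cancel R by (rule comm_monoid_cancel_R)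
  show ?thesis
  proof
    fix p w
    assume p: "p \<in> atoms R" and w: "set_mset w \<subseteq> carrier R" "p divides\<^bsub>R\<^esub> mset_prod R w"
    obtain q where q: "q \<in> atoms G" "p = cls q" using p by (auto simp: atoms_R)
    have om: "omega_at G q \<le> enat N"
      using q unfolding assms[symmetric] omega_def by (intro SUP_upper)
    have "cls q divides\<^bsub>R\<^esub> mset_prod R w" using w(2) q(2) by simp
    then obtain s where "s \<subseteq># w" "size s \<le> N" "cls q divides\<^bsub>R\<^esub> mset_prod R s"
      by (rule omega_at_R[OF atoms_closed[OF q(1)] om w(1)])
    then show "\<exists>s. s \<subseteq># w \<and> size s \<le> N \<and> p divides\<^bsub>R\<^esub> mset_prod R s"
      using q(2) by blast
  qed
qed

theorem theorem3p5:
  fixes H :: "('a, 'b) monoid_scheme"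
  assumes "unit_cancellative_monoid H" and "atomic H"
  shows
    "(catenary_degree H < \<infinity> \<and> accepted_elasticity H \<longrightarrow>
        finite (distances H) \<and>
        (\<exists>K::nat. \<forall>k\<ge>1. rho H (k + 1) \<le> rho H k + enat K) \<and>
        structure_theorem_for_unions H)
     \<and>
     (comm_monoid_cancel H \<and> omega H < \<infinity> \<longrightarrow>
        catenary_degree H \<le> tame_degree H \<and>
        tame_degree H \<le> (omega H)\<^sup>2 \<and>
        (carrier H \<noteq> Units H \<longrightarrow> elasticity H \<le> ennreal_of_enat (omega H)) \<and>
        (\<forall>k\<ge>1. rho H (k + 1) \<le> rho H k + max 1 (omega H - 1)) \<and>
        structure_theorem_for_unions H)"
proof (intro conjI[of "_ \<longrightarrow> _"] impI; elim conjE)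
  interpret comm_monoid H using assms(1) by (simp add: unit_cancellative_monoid_def)
  \<comment> \<open>For a group the union for \<open>k\<close> is \<open>{k}\<close> by convention,
    so \<open>1\<close> is a valid increment.\<close>
  have group_rho: "rho H (k + 1) \<le> rho H k + enat 1" if "carrier H = Units H" for k
    using that by (intro rho_Suc_le) (simp add: unions_def)
  {
    assume cat: "catenary_degree H < \<infinity>" and acc: "accepted_elasticity H"
    have fin: "finite (distances H)" using cat by (rule finite_distances)
    show "finite (distances H) \<and> (\<exists>K::nat. \<forall>k\<ge>1. rho H (k + 1) \<le> rho H k + enat K) \<and>
        structure_theorem_for_unions H"
    proof (cases "carrier H = Units H")
      case True
      then show ?thesis using fin group_rho structure_theorem_for_unions_group by blast
    next
      case False
      obtain K where K: "\<And>k. k \<ge> 1 \<Longrightarrow> finite (unions H k)"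
        "\<And>k l. \<lbrakk>k \<ge> 1; l \<in> unions H (k + 1)\<rbrakk> \<Longrightarrow> \<exists>l'\<in>unions H k. l \<le> l' + K"
        using accepted_elasticity_bounds[OF assms(2) False acc] by blast
      then have "structure_theorem_for_unions H"
        using assms(2) False fin by (rule structure_theorem_for_unionsI[rotated 3])
      moreover have "rho H (k + 1) \<le> rho H k + enat K" if "k \<ge> 1" for k
        using K(2)[OF that] by (rule rho_Suc_le)
      ultimately show ?thesis using fin by blast
    qed
  next
    assume "comm_monoid_cancel H" and om: "omega H < \<infinity>"
    interpret comm_monoid_cancel H by fact
    obtain N where N: "omega H = enat N" using om by auto
    interpret R: cancellative_omega_bounded R N using N by (rule cancellative_omega_bounded_R)
    have factor: "\<exists>z. set_mset z \<subseteq> atoms R \<and> mset_prod R z = x" if "x \<in> carrier R" for x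
      using atomic_R[OF assms(2) that] by metis
    have cat: "catenary_degree H \<le> tame_degree H"
      using R.chain_of_tame_steps[OF tame_degree_step[OF assms(2)]] by (intro catenary_degree_le)
    have tame: "tame_degree H \<le> (omega H)\<^sup>2"
    proof (rule tame_degree_le)
      fix p z assume "p \<in> atoms R" "set_mset z \<subseteq> atoms R" "p divides\<^bsub>R\<^esub> mset_prod R z"
      then obtain y where "set_mset y \<subseteq> atoms R" "mset_prod R (add_mset p y) = mset_prod R z"
        "fdist z (add_mset p y) \<le> N * N"
        using R.tame_bound[OF _ _ _ factor] by metis
      then show "\<exists>y. set_mset y \<subseteq> atoms R \<and> mset_prod R (add_mset p y) = mset_prod R z \<and>
        enat (fdist z (add_mset p y)) \<le> (omega H)\<^sup>2"
        by (auto simp: N power2_eq_square)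
    qed
    have "(omega H)\<^sup>2 < \<infinity>" by (simp add: N power2_eq_square)
    with tame have "tame_degree H < \<infinity>" by (rule le_less_trans)
    then have fin: "finite (distances H)" using cat by (intro finite_distances) (rule le_less_trans)
    have max: "max 1 (omega H - 1) = enat (max 1 (N - 1))"
      by (simp add: N one_enat_def max_def)
    show "catenary_degree H \<le> tame_degree H \<and> tame_degree H \<le> (omega H)\<^sup>2 \<and>
        (carrier H \<noteq> Units H \<longrightarrow> elasticity H \<le> ennreal_of_enat (omega H)) \<and>
        (\<forall>k\<ge>1. rho H (k + 1) \<le> rho H k + max 1 (omega H - 1)) \<and>
        structure_theorem_for_unions H"
    proof (cases "carrier H = Units H")
      case True
      have "rho H (k + 1) \<le> rho H k + enat (max 1 (N - 1))" for k
      proof -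
        have "rho H (k + 1) \<le> rho H k + enat 1" using True by (rule group_rho)
        also have "\<dots> \<le> rho H k + enat (max 1 (N - 1))" by (intro add_left_mono) simp
        finally show ?thesis .
      qed
      then show ?thesis using True cat tame max structure_theorem_for_unions_group by auto
    next
      case False
      have bound: "l \<le> k * N" if "l \<in> unions H k" for k l
        using that R.size_le_size_mult' unfolding mem_unions_iff[OF False] by metis
      obtain p where p: "p \<in> atoms H" using ex_atom[OF assms(2) False] .
      \<comment> \<open>An atom has length \<open>1\<close>, so \<open>bound\<close> gives
        \<open>1 \<le> N\<close>, as the default value \<open>1\<close> in
        \<open>elasticity_of_set_le\<close> requires.\<close>
      have "N \<ge> 1"
      proof (rule ccontr)
        assume "\<not> N \<ge> 1"
        have "1 \<in> unions H 1"
          using length_set_atom[OF p] atoms_closed[OF p] False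
          by (auto simp: unions_def length_system_def)
        with bound[of 1 1] \<open>\<not> N \<ge> 1\<close> show False by simp
      qed
      have "elasticity_of_set L \<le> of_nat N" if "L \<in> length_system H" for L
        using that False \<open>N \<ge> 1\<close> by (intro elasticity_of_set_le bound) (auto simp: unions_def)
      then have "elasticity H \<le> of_nat N" unfolding elasticity_def by (rule SUP_least)
      then have elast: "elasticity H \<le> ennreal_of_enat (omega H)" by (simp add: N)
      have step: "\<exists>l'\<in>unions H k. l \<le> l' + max 1 (N - 1)"
        if k: "k \<ge> 1" and l: "l \<in> unions H (k + 1)" for k l
      proof -
        obtain v z where vz: "set_mset v \<subseteq> atoms R" "set_mset z \<subseteq> atoms R"
          "mset_prod R v = mset_prod R z" "size v = k + 1" "size z = l"
          using l unfolding mem_unions_iff[OF False] by blast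
        \<comment> \<open>Any one atom of \<open>v\<close> is split off. The factorization
          \<open>w\<close> found below has the same product as the rest \<open>v'\<close> of length
          \<open>k\<close>, so its length lies in \<open>unions H k\<close>.\<close>
        then obtain p v' where v: "v = add_mset p v'" by (cases v) auto
        then have v': "p \<in> atoms R" "set_mset v' \<subseteq> atoms R" "size v' = k" "v' \<noteq> {#}"
          using vz k by auto
        have "mset_prod R z = mset_prod R (add_mset p v')" using vz(3) v by simp
        then obtain w where "set_mset w \<subseteq> atoms R" "mset_prod R w = mset_prod R v'"
          "size z \<le> size w + max 1 (N - 1)"
          using R.remove_atom_bound[OF v'(1,2,4) vz(2) _ Units_R factor] by metis
        moreover from this have "size w \<in> unions H k"
          unfolding mem_unions_iff[OF False] using v' by metis
        ultimately show ?thesis using vz by blast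
      qed
      have "unions H k \<subseteq> {..k * N}" for k using bound by blast
      then have "finite (unions H k)" for k by (rule finite_subset) simp
      then have "structure_theorem_for_unions H"
        using assms(2) False fin step by (intro structure_theorem_for_unionsI)
      moreover have "rho H (k + 1) \<le> rho H k + enat (max 1 (N - 1))" if "k \<ge> 1" for k
        using step[OF that] by (rule rho_Suc_le)
      ultimately show ?thesis using cat tame elast max by simp
    qed
  }
qed

end
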